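(* Let $\mathcal{M}=(\mathcal{C}_1,\ldots,\mathcal{C}_n,\mathcal{G})$ be a multi-space system, let $\mathbb{S}$ be a set of schemas for $\mathcal{M}$ and let $\langle\kappa_1',\ldots,\kappa_n',\alpha'\Vdash\gamma'\rangle$ be a sequent for $\mathcal{M}$. If $\langle\kappa_1',\ldots,\kappa_n',\alpha'\Vdash\gamma'\rangle$ is valid over $\mathbb{S}$, then it is also a schema for $\mathcal{M}$.
   Context: **Graphs.** A graph is a tuple $g=(V_1,V_2,A,\mathit{iv},l_A,l_1,l_2)$ with disjoint sets $V_1,V_2$ of vertices, a set $A$ of arrows disjoint from $V_1\cup V_2$, a function $\mathit{iv}\colon A\to (V_1\times V_2)\cup(V_2\times V_1)$ giving source and target of arrows, and labelling functions $l_A,l_1,l_2$ on $A,V_1,V_2$. Two graphs are compatible if their componentwise union is a graph; unions and intersections of compatible graphs are componentwise. A homomorphism $f\colon g\to g'$ is a function $V_1\cup V_2\cup A\to V_1'\cup V_2'\cup A'$ mapping $V_1$ into $V_1'$, $V_2$ into $V_2'$, $A$ into $A'$ and such that $\mathit{iv}(a)=(u,v)$ implies $\mathit{iv}'(f(a))=(f(u),f(v))$; $f[g]$ is its image, a subgraph of $g'$. An isomorphism is a bijective homomorphism; a monomorphism is a homomorphism that is an isomorphism onto its image. A homomorphism of tuples $f\colon (g_1,\ldots,g_m)\to(h_1,\ldots,h_m)$ is a homomorphism $g_1\cup\cdots\cup g_m\to h_1\cup\cdots\cup h_m$ with $f[g_i]\subseteq h_i$ for all $i$. **Construction spaces.**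 A type system is $T=(\mathit{Ty},\leq)$, a partially ordered set of types. A constructor specification over $T$ is $C=(\mathit{Co},\mathit{sig})$ with $\mathit{Co}$ a set (of constructors) disjoint from $\mathit{Ty}$ and $\mathit{sig}(c)=([\tau_1,\ldots,\tau_k],\tau)$, $k>0$, types. A structure graph for $C$ is a graph $(\mathit{To},\mathit{Cr},A,\mathit{iv},\mathit{index},\mathit{type},\mathit{co})$ where elements of $\mathit{To}$ are called tokens, $\mathit{type}\colon\mathit{To}\to\mathit{Ty}$, $\mathit{co}\colon\mathit{Cr}\to\mathit{Co}$, $\mathit{index}\colon A\to\mathbb{N}$ is partial, and for each $u\in\mathit{Cr}$ with $\mathit{sig}(\mathit{co}(u))=([\tau_1,\ldots,\tau_k],\tau)$: $u$ has exactly one outgoing arrow, on which $\mathit{index}$ is undefined, and its target token has type $\leq\tau$; $u$ has at least one incoming arrow, $\mathit{index}$ restricted to the incoming arrows of $u$ is a bijection onto $\{1,\ldots,k\}$, and the source token of incoming arrow $a$ has type $\leq\tau_{\mathit{index}(a)}$. A construction space is $\mathcal{C}=(T,C,G)$ with $G$ a structure graph for $C$, called its realm; a structure graph belongs to $\mathcal{C}$ (is a construction graph for $\mathcal{C}$) if it is a subgraph of $G$. Unions of construction spaces are componentwise. A multi-space system is a tuple $\mathcal{M}=(\mathcal{C}_1,\ldots,\mathcal{C}_n,\mathcal{G})$ of construction spaces such that the order of the type system of each $\mathcal{C}_i$ is contained in that of $\mathcal{G}$, and $\mathcal{C}_1\cup\cdots\cup\mathcal{C}_n\cup\mathcal{G}$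 (the superspace) is a construction space. $\mathcal{G}$ is called the meta-space. A tuple $(g_1,\ldots,g_n,g)$ with $g_i$ belonging to $\mathcal{C}_i$ and $g$ to $\mathcal{G}$ is a construction graph that belongs to $\mathcal{M}$. **Specialisation, patterns.** For construction graphs $\kappa$, $g$ of construction spaces with the same $T$ and $C$, a specialisation function $s\colon\kappa\to g$ is an isomorphism that preserves constructor labels and such that, for each token $t$ of $\kappa$, the type of $s(t)$ is a subtype ($\leq$) of the type of $t$. A pattern space for $\mathcal{C}=(T,C,G)$ is a construction space $(T,C,\Gamma)$ such that $G$ is a specialisation of some subgraph of $\Gamma$. A pattern graph for $\mathcal{C}$ is a structure graph that belongs to some pattern space for $\mathcal{C}$. A pattern system for $\mathcal{M}$ is a multi-space system $(\mathcal{P}_1,\ldots,\mathcal{P}_n,\mathcal{P})$ with $\mathcal{P}_i$ a pattern space for $\mathcal{C}_i$, $\mathcal{P}$ one for $\mathcal{G}$, and $\mathcal{P}_1\cup\cdots\cup\mathcal{P}_n\cup\mathcal{P}$ one for the superspace. All pattern graphs are drawn from one fixed pattern system for $\mathcal{M}$ (so they are compatible). A pattern graph for $\mathcal{M}$ is a tuple $(\kappa_1,\ldots,\kappa_n,\kappa)$ of pattern graphs $\kappa_i$ for $\mathcal{C}_i$ and $\kappa$ for $\mathcal{G}$. A reification function $f\colon\kappa\to\kappa'$ is a monomorphism such that $f\colon\kappa\to f[\kappa]$ is a specialisation function. A loosening map $\ell\colon\kappa'\to\kappa$ is a partial surjective function whose inverse is a reification function; it is a loosening map up to a set $W$ of tokens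 of $\kappa'$ if the requirement that $\ell$ generalises types (the type of $\ell(t)$ is a supertype of that of $t$) is imposed only on tokens $t\notin W$ of its domain of definition. A homomorphism of tuples $(\kappa_1,\ldots,\kappa_n,\kappa)\to(\kappa_1',\ldots,\kappa_n',\kappa')$ is a specialisation (resp. reification) function in $\mathcal{M}$ if each of its restrictions $\kappa_i\to\kappa_i'$, $\kappa\to\kappa'$ is one. A pattern graph for $\mathcal{M}$ is instantiatable if some construction graph belonging to $\mathcal{M}$ specialises it. A specialisation function between pattern graphs for $\mathcal{M}$ is instantiatable if its codomain is instantiatable. **Sequents and schemas.** A sequent $\langle\kappa_1,\ldots,\kappa_n,\alpha\Vdash\gamma\rangle$ for $\mathcal{M}$ consists of a pattern graph $(\kappa_1,\ldots,\kappa_n,\alpha)$ for $\mathcal{M}$ and a pattern graph $\gamma$ for $\mathcal{G}$. It is a schema for $\mathcal{M}$ if every instantiatable specialisation function $s\colon(\kappa_1,\ldots,\kappa_n,\alpha)\to(\kappa_1',\ldots,\kappa_n',\alpha')$ extends to an instantiatable specialisation function $s'\colon(\kappa_1,\ldots,\kappa_n,\alpha\cup\gamma)\to(\kappa_1',\ldots,\kappa_n',\alpha'\cup\gamma')$ for some $\gamma'$. A schema $\langle\kappa_1,\ldots,\kappa_n,\alpha\Vdash\gamma\rangle$ is monotonic for a pattern graph $(\kappa_1',\ldots,\kappa_n',\alpha')$ in $\mathcal{M}$ if $\langle\kappa_1\cup\kappa_1',\ldots,\kappa_n\cup\kappa_n',\alpha\cup\alpha'\Vdash\gamma\rangle$ is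 a schema for $\mathcal{M}$. **Weakening, refinement, application.** A weakening map from $\langle\kappa_1,\ldots,\kappa_n,\alpha\Vdash\gamma\rangle$ to $\langle\kappa_1',\ldots,\kappa_n',\alpha'\Vdash\gamma'\rangle$ is a partial function $r\colon(\kappa_1,\ldots,\kappa_n,\alpha\cup\gamma)\to(\kappa_1',\ldots,\kappa_n',\alpha'\cup\gamma')$ such that $r|_{(\kappa_1,\ldots,\kappa_n,\alpha)}$ is a reification function (into $(\kappa_1',\ldots,\kappa_n',\alpha')$) and $r|_\gamma$ is a loosening map (onto its image $r[\gamma]$) up to the tokens in $(\kappa_1\cup\cdots\cup\kappa_n\cup\alpha)\cap\gamma$. A sequent $\langle\kappa_1',\ldots,\kappa_n',\alpha'\Vdash\gamma'\rangle$ is a refinement of a schema $\langle\kappa_1,\ldots,\kappa_n,\alpha\Vdash\gamma\rangle$ if there is a weakening map $r\colon(\kappa_1,\ldots,\kappa_n,\alpha\cup\gamma)\to(\kappa_1',\ldots,\kappa_n',\alpha'\cup r[\gamma])$ such that $\langle r[\kappa_1],\ldots,r[\kappa_n],r[\alpha]\Vdash r[\gamma]\rangle$ is monotonic for $(\kappa_1',\ldots,\kappa_n',\alpha')$ in $\mathcal{M}$ and $\gamma'\subseteq\alpha'\cup r[\gamma]$. An application of a schema $S=\langle\kappa_1,\ldots,\kappa_n,\alpha\Vdash\gamma\rangle$ to a sequent $\langle\kappa_1',\ldots,\kappa_n',\alpha'\Vdash\gamma'\rangle$ is either (1) a sequent $\langle\kappa_1',\ldots,\kappa_n',\alpha'\cup\delta\Vdash\gamma'\rangle$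 where $\langle\kappa_1',\ldots,\kappa_n',\alpha'\Vdash\delta\rangle$ is a refinement of $S$, or (2) a sequent $\langle\kappa_1',\ldots,\kappa_n',\alpha'\Vdash\delta\rangle$ where $\langle\kappa_1',\ldots,\kappa_n',\alpha'\cup\delta\Vdash\gamma'\rangle$ is a refinement of $S$. **Validity.** For a set $\mathbb{S}$ of schemas for $\mathcal{M}$, validity over $\mathbb{S}$ is defined recursively: a sequent is valid over $\mathbb{S}$ if it is in $\mathbb{S}$, or if some application of some schema in $\mathbb{S}$ to it is valid over $\mathbb{S}$. *)

theory Defs
  imports Main
begin

section \<open>Graphs\<close>

text \<open>
  The functions that are components of a structure (incidence, labellings, signatures) are
  single-valued relations. Componentwise union and inclusion are then literally union and
  inclusion of sets, and a union of structures that disagree somewhere fails to be a structure.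
\<close>

definition function_on :: "'a set \<Rightarrow> ('a \<times> 'b) set \<Rightarrow> bool" where
  "function_on A r \<longleftrightarrow> single_valued r \<and> Domain r = A"

definition app :: "('a \<times> 'b) set \<Rightarrow> 'a \<Rightarrow> 'b" where
  "app r x = (THE y. (x, y) \<in> r)"

text \<open>
  The vertices in \<open>To\<close> and \<open>Cr\<close> (the two vertex classes) and the arrows live in one type
  \<open>'x\<close>, since homomorphisms are functions on their union.
\<close>

record ('x, 'ty, 'co) graph =
  To :: "'x set"
  Cr :: "'x set"
  Arr :: "'x set"
  iv :: "('x \<times> 'x \<times> 'x) set"
  idx :: "('x \<times> nat) set"
  tok_type :: "('x \<times> 'ty) set"
  con_label :: "('x \<times> 'co) set"

definition carrier :: "('x, 'ty, 'co) graph \<Rightarrow> 'x set" where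
  "carrier g = To g \<union> Cr g \<union> Arr g"

text \<open>The arrow labelling \<open>idx\<close> may be partial, as it is for structure graphs.\<close>

definition is_graph :: "('x, 'ty, 'co) graph \<Rightarrow> bool" where
  "is_graph g \<longleftrightarrow>
     To g \<inter> Cr g = {} \<and> Arr g \<inter> (To g \<union> Cr g) = {} \<and>
     function_on (Arr g) (iv g) \<and> Range (iv g) \<subseteq> To g \<times> Cr g \<union> Cr g \<times> To g \<and>
     single_valued (idx g) \<and> Domain (idx g) \<subseteq> Arr g \<and>
     function_on (To g) (tok_type g) \<and> function_on (Cr g) (con_label g)"

definition gUnion :: "('x, 'ty, 'co) graph set \<Rightarrow> ('x, 'ty, 'co) graph" where
  "gUnion X = \<lparr> To = (\<Union>g\<in>X. To g), Cr = (\<Union>g\<in>X. Cr g), Arr = (\<Union>g\<in>X. Arr g),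
     iv = (\<Union>g\<in>X. iv g), idx = (\<Union>g\<in>X. idx g), tok_type = (\<Union>g\<in>X. tok_type g),
     con_label = (\<Union>g\<in>X. con_label g) \<rparr>"

abbreviation gunion ::
  "('x, 'ty, 'co) graph \<Rightarrow> ('x, 'ty, 'co) graph \<Rightarrow> ('x, 'ty, 'co) graph"
  (infixl \<open>\<union>\<^sub>g\<close> 65) where
  "g \<union>\<^sub>g h \<equiv> gUnion {g, h}"

definition subgraph :: "('x, 'ty, 'co) graph \<Rightarrow> ('x, 'ty, 'co) graph \<Rightarrow> bool"
  (infix \<open>\<subseteq>\<^sub>g\<close> 50) where
  "g \<subseteq>\<^sub>g h \<longleftrightarrow> To g \<subseteq> To h \<and> Cr g \<subseteq> Cr h \<and> Arr g \<subseteq> Arr h \<and> iv g \<subseteq> iv h \<and>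
     idx g \<subseteq> idx h \<and> tok_type g \<subseteq> tok_type h \<and> con_label g \<subseteq> con_label h"

definition homomorphism ::
  "('x \<Rightarrow> 'x) \<Rightarrow> ('x, 'ty, 'co) graph \<Rightarrow> ('x, 'ty, 'co) graph \<Rightarrow> bool" where
  "homomorphism f g h \<longleftrightarrow>
     f ` To g \<subseteq> To h \<and> f ` Cr g \<subseteq> Cr h \<and> f ` Arr g \<subseteq> Arr h \<and>
     (\<forall>a u v. (a, u, v) \<in> iv g \<longrightarrow> (f a, f u, f v) \<in> iv h)"

text \<open>
  \<open>pimage r g h\<close> is the image \<open>r[g]\<close> of \<open>g\<close> under a partial function \<open>r\<close> into \<open>h\<close>; as a
  subgraph of \<open>h\<close>, it takes its incidence function and labels from \<open>h\<close>.
\<close>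

definition pimage ::
  "('x \<rightharpoonup> 'x) \<Rightarrow> ('x, 'ty, 'co) graph \<Rightarrow> ('x, 'ty, 'co) graph \<Rightarrow> ('x, 'ty, 'co) graph" where
  "pimage r g h =
     (let im = (\<lambda>X. {y. \<exists>x\<in>X. r x = Some y}) in
      \<lparr> To = im (To g), Cr = im (Cr g), Arr = im (Arr g),
        iv = {(a, p) \<in> iv h. a \<in> im (Arr g)},
        idx = {(a, i) \<in> idx h. a \<in> im (Arr g)},
        tok_type = {(t, \<tau>) \<in> tok_type h. t \<in> im (To g)},
        con_label = {(u, c) \<in> con_label h. u \<in> im (Cr g)} \<rparr>)"

abbreviation gimage ::
  "('x \<Rightarrow> 'x) \<Rightarrow> ('x, 'ty, 'co) graph \<Rightarrow> ('x, 'ty, 'co) graph \<Rightarrow> ('x, 'ty, 'co) graph" where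
  "gimage f \<equiv> pimage (\<lambda>x. Some (f x))"

definition isomorphism ::
  "('x \<Rightarrow> 'x) \<Rightarrow> ('x, 'ty, 'co) graph \<Rightarrow> ('x, 'ty, 'co) graph \<Rightarrow> bool" where
  "isomorphism f g h \<longleftrightarrow> homomorphism f g h \<and> bij_betw f (carrier g) (carrier h)"

definition monomorphism ::
  "('x \<Rightarrow> 'x) \<Rightarrow> ('x, 'ty, 'co) graph \<Rightarrow> ('x, 'ty, 'co) graph \<Rightarrow> bool" where
  "monomorphism f g h \<longleftrightarrow> homomorphism f g h \<and> isomorphism f g (gimage f g h)"

definition tuple_homomorphism ::
  "('x \<Rightarrow> 'x) \<Rightarrow> ('x, 'ty, 'co) graph list \<Rightarrow> ('x, 'ty, 'co) graph list \<Rightarrow> bool" where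
  "tuple_homomorphism f gs hs \<longleftrightarrow>
     length gs = length hs \<and>
     homomorphism f (gUnion (set gs)) (gUnion (set hs)) \<and>
     (\<forall>i<length gs. gimage f (gs ! i) (gUnion (set hs)) \<subseteq>\<^sub>g hs ! i)"


section \<open>Construction spaces\<close>

record 'ty type_system =
  types :: "'ty set"
  ty_le :: "'ty rel"

definition is_type_system :: "'ty type_system \<Rightarrow> bool" where
  "is_type_system T \<longleftrightarrow> partial_order_on (types T) (ty_le T)"

text \<open>Types and constructors are of different HOL types, which makes them disjoint.\<close>

record ('ty, 'co) cons_spec =
  Co :: "'co set"
  sig :: "('co \<times> 'ty list \<times> 'ty) set"

definition is_cons_spec :: "'ty type_system \<Rightarrow> ('ty, 'co) cons_spec \<Rightarrow> bool" where
  "is_cons_spec T C \<longleftrightarrow>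
     function_on (Co C) (sig C) \<and>
     (\<forall>c \<tau>s \<tau>. (c, \<tau>s, \<tau>) \<in> sig C \<longrightarrow> \<tau>s \<noteq> [] \<and> set \<tau>s \<subseteq> types T \<and> \<tau> \<in> types T)"

definition outgoing :: "('x, 'ty, 'co) graph \<Rightarrow> 'x \<Rightarrow> 'x set" where
  "outgoing g u = {a. \<exists>v. (a, u, v) \<in> iv g}"

definition incoming :: "('x, 'ty, 'co) graph \<Rightarrow> 'x \<Rightarrow> 'x set" where
  "incoming g u = {a. \<exists>v. (a, v, u) \<in> iv g}"

definition structure_graph ::
  "'ty type_system \<Rightarrow> ('ty, 'co) cons_spec \<Rightarrow> ('x, 'ty, 'co) graph \<Rightarrow> bool" where
  "structure_graph T C g \<longleftrightarrow>
     is_graph g \<and> Range (tok_type g) \<subseteq> types T \<and> Range (con_label g) \<subseteq> Co C \<and>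
     (\<forall>u\<in>Cr g. \<forall>\<tau>s \<tau>. (app (con_label g) u, \<tau>s, \<tau>) \<in> sig C \<longrightarrow>
        (\<exists>a t. outgoing g u = {a} \<and> a \<notin> Domain (idx g) \<and>
           (a, u, t) \<in> iv g \<and> (app (tok_type g) t, \<tau>) \<in> ty_le T) \<and>
        incoming g u \<noteq> {} \<and> incoming g u \<subseteq> Domain (idx g) \<and>
        bij_betw (app (idx g)) (incoming g u) {1..length \<tau>s} \<and>
        (\<forall>a t. (a, t, u) \<in> iv g \<longrightarrow>
           (app (tok_type g) t, \<tau>s ! (app (idx g) a - 1)) \<in> ty_le T))"

record ('x, 'ty, 'co) space =
  tsys :: "'ty type_system"
  cspec :: "('ty, 'co) cons_spec"
  realm :: "('x, 'ty, 'co) graph"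

definition construction_space :: "('x, 'ty, 'co) space \<Rightarrow> bool" where
  "construction_space X \<longleftrightarrow>
     is_type_system (tsys X) \<and> is_cons_spec (tsys X) (cspec X) \<and>
     structure_graph (tsys X) (cspec X) (realm X)"

definition belongs_to :: "('x, 'ty, 'co) graph \<Rightarrow> ('x, 'ty, 'co) space \<Rightarrow> bool" where
  "belongs_to g X \<longleftrightarrow> structure_graph (tsys X) (cspec X) g \<and> g \<subseteq>\<^sub>g realm X"

definition space_Union :: "('x, 'ty, 'co) space set \<Rightarrow> ('x, 'ty, 'co) space" where
  "space_Union Xs =
     \<lparr> tsys = \<lparr> types = (\<Union>X\<in>Xs. types (tsys X)), ty_le = (\<Union>X\<in>Xs. ty_le (tsys X)) \<rparr>,
       cspec = \<lparr> Co = (\<Union>X\<in>Xs. Co (cspec X)), sig = (\<Union>X\<in>Xs. sig (cspec X)) \<rparr>,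
       realm = gUnion (realm ` Xs) \<rparr>"

record ('x, 'ty, 'co) multi_space =
  object_spaces :: "('x, 'ty, 'co) space list"
  meta_space :: "('x, 'ty, 'co) space"

text \<open>
  The tuple \<open>(C\<^sub>1, \<dots>, C\<^sub>n, G)\<close> as a list of length \<open>n + 1\<close>. Tuples of graphs in a multi-space
  system, such as \<open>(\<kappa>\<^sub>1, \<dots>, \<kappa>\<^sub>n, \<alpha>)\<close>, are likewise lists \<open>\<kappa>s @ [\<alpha>]\<close> of length \<open>n + 1\<close>.
\<close>

definition all_spaces :: "('x, 'ty, 'co) multi_space \<Rightarrow> ('x, 'ty, 'co) space list" where
  "all_spaces M = object_spaces M @ [meta_space M]"

definition superspace :: "('x, 'ty, 'co) multi_space \<Rightarrow> ('x, 'ty, 'co) space" where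
  "superspace M = space_Union (set (all_spaces M))"

definition multi_space_system :: "('x, 'ty, 'co) multi_space \<Rightarrow> bool" where
  "multi_space_system M \<longleftrightarrow>
     (\<forall>X\<in>set (all_spaces M). construction_space X) \<and>
     (\<forall>X\<in>set (object_spaces M). ty_le (tsys X) \<subseteq> ty_le (tsys (meta_space M))) \<and>
     construction_space (superspace M)"

definition belongs_to_system ::
  "('x, 'ty, 'co) graph list \<Rightarrow> ('x, 'ty, 'co) multi_space \<Rightarrow> bool" where
  "belongs_to_system gs M \<longleftrightarrow> list_all2 belongs_to gs (all_spaces M)"


section \<open>Specialisation and patterns\<close>

text \<open>
  In the notions ending in \<open>_upto\<close> the typing requirement is waived on a set \<open>W\<close> of tokens of
  the codomain of the function (the domain of its inverse, for loosening maps).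
  Being a construction graph of some construction space with type system \<open>T\<close> and constructor
  specification \<open>C\<close> means being a structure graph for \<open>C\<close> over \<open>T\<close>.
\<close>

definition specialisation_upto ::
  "'ty type_system \<Rightarrow> ('ty, 'co) cons_spec \<Rightarrow> 'x set \<Rightarrow> ('x \<Rightarrow> 'x) \<Rightarrow>
   ('x, 'ty, 'co) graph \<Rightarrow> ('x, 'ty, 'co) graph \<Rightarrow> bool" where
  "specialisation_upto T C W s \<kappa> g \<longleftrightarrow>
     structure_graph T C \<kappa> \<and> structure_graph T C g \<and> isomorphism s \<kappa> g \<and>
     (\<forall>u\<in>Cr \<kappa>. app (con_label g) (s u) = app (con_label \<kappa>) u) \<and>
     (\<forall>t\<in>To \<kappa>. s t \<notin> W \<longrightarrow> (app (tok_type g) (s t), app (tok_type \<kappa>) t) \<in> ty_le T)"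

abbreviation specialisation ::
  "'ty type_system \<Rightarrow> ('ty, 'co) cons_spec \<Rightarrow> ('x \<Rightarrow> 'x) \<Rightarrow>
   ('x, 'ty, 'co) graph \<Rightarrow> ('x, 'ty, 'co) graph \<Rightarrow> bool" where
  "specialisation T C \<equiv> specialisation_upto T C {}"

definition reification_upto ::
  "'ty type_system \<Rightarrow> ('ty, 'co) cons_spec \<Rightarrow> 'x set \<Rightarrow> ('x \<Rightarrow> 'x) \<Rightarrow>
   ('x, 'ty, 'co) graph \<Rightarrow> ('x, 'ty, 'co) graph \<Rightarrow> bool" where
  "reification_upto T C W f \<kappa> \<kappa>' \<longleftrightarrow>
     monomorphism f \<kappa> \<kappa>' \<and> specialisation_upto T C W f \<kappa> (gimage f \<kappa> \<kappa>')"

abbreviation reification ::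
  "'ty type_system \<Rightarrow> ('ty, 'co) cons_spec \<Rightarrow> ('x \<Rightarrow> 'x) \<Rightarrow>
   ('x, 'ty, 'co) graph \<Rightarrow> ('x, 'ty, 'co) graph \<Rightarrow> bool" where
  "reification T C \<equiv> reification_upto T C {}"

text \<open>
  The first conjunct says that the inverse of \<open>l\<close> is \<open>f\<close> restricted to \<open>\<kappa>\<close>; so \<open>l\<close> is injective
  on its domain, which is contained in \<open>\<kappa>'\<close>, and its range is all of \<open>\<kappa>\<close>.
\<close>

definition loosening_upto ::
  "'ty type_system \<Rightarrow> ('ty, 'co) cons_spec \<Rightarrow> 'x set \<Rightarrow> ('x \<rightharpoonup> 'x) \<Rightarrow>
   ('x, 'ty, 'co) graph \<Rightarrow> ('x, 'ty, 'co) graph \<Rightarrow> bool" where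
  "loosening_upto T C W l \<kappa>' \<kappa> \<longleftrightarrow>
     (\<exists>f. (\<forall>x y. l x = Some y \<longleftrightarrow> y \<in> carrier \<kappa> \<and> x = f y) \<and> reification_upto T C W f \<kappa> \<kappa>')"

definition pattern_space :: "('x, 'ty, 'co) space \<Rightarrow> ('x, 'ty, 'co) space \<Rightarrow> bool" where
  "pattern_space X P \<longleftrightarrow>
     construction_space P \<and> tsys P = tsys X \<and> cspec P = cspec X \<and>
     (\<exists>\<kappa> s. belongs_to \<kappa> P \<and> specialisation (tsys X) (cspec X) s \<kappa> (realm X))"

definition pattern_system ::
  "('x, 'ty, 'co) multi_space \<Rightarrow> ('x, 'ty, 'co) multi_space \<Rightarrow> bool" where
  "pattern_system M P \<longleftrightarrow>
     multi_space_system P \<and> list_all2 pattern_space (all_spaces M) (all_spaces P) \<and>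
     pattern_space (superspace M) (superspace P)"

definition multi_specialisation ::
  "('x, 'ty, 'co) multi_space \<Rightarrow> ('x \<Rightarrow> 'x) \<Rightarrow>
   ('x, 'ty, 'co) graph list \<Rightarrow> ('x, 'ty, 'co) graph list \<Rightarrow> bool" where
  "multi_specialisation M s gs hs \<longleftrightarrow>
     length gs = length (all_spaces M) \<and> tuple_homomorphism s gs hs \<and>
     (\<forall>i<length gs. specialisation (tsys (all_spaces M ! i)) (cspec (all_spaces M ! i))
        s (gs ! i) (hs ! i))"

definition multi_reification ::
  "('x, 'ty, 'co) multi_space \<Rightarrow> ('x \<Rightarrow> 'x) \<Rightarrow>
   ('x, 'ty, 'co) graph list \<Rightarrow> ('x, 'ty, 'co) graph list \<Rightarrow> bool" where
  "multi_reification M f gs hs \<longleftrightarrow>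
     length gs = length (all_spaces M) \<and> tuple_homomorphism f gs hs \<and>
     (\<forall>i<length gs. reification (tsys (all_spaces M ! i)) (cspec (all_spaces M ! i))
        f (gs ! i) (hs ! i))"

definition instantiatable ::
  "('x, 'ty, 'co) multi_space \<Rightarrow> ('x, 'ty, 'co) graph list \<Rightarrow> bool" where
  "instantiatable M \<kappa>s \<longleftrightarrow> (\<exists>gs s. belongs_to_system gs M \<and> multi_specialisation M s \<kappa>s gs)"


section \<open>Sequents and schemas\<close>

text \<open>
  From here on, \<open>P\<close> is the fixed pattern system for \<open>M\<close> from which all pattern graphs are
  drawn: a pattern graph for \<open>M\<close> is a tuple that belongs to \<open>P\<close>, and a pattern graph for the
  meta-space of \<open>M\<close> is a graph that belongs to the meta-space of \<open>P\<close>.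
\<close>

datatype ('x, 'ty, 'co) sequent =
  Sequent "('x, 'ty, 'co) graph list" "('x, 'ty, 'co) graph" "('x, 'ty, 'co) graph"

fun is_sequent :: "('x, 'ty, 'co) multi_space \<Rightarrow> ('x, 'ty, 'co) sequent \<Rightarrow> bool" where
  "is_sequent P (Sequent \<kappa>s \<alpha> \<gamma>) \<longleftrightarrow>
     belongs_to_system (\<kappa>s @ [\<alpha>]) P \<and> belongs_to \<gamma> (meta_space P)"

fun schema ::
  "('x, 'ty, 'co) multi_space \<Rightarrow> ('x, 'ty, 'co) multi_space \<Rightarrow>
   ('x, 'ty, 'co) sequent \<Rightarrow> bool" where
  "schema M P (Sequent \<kappa>s \<alpha> \<gamma>) \<longleftrightarrow>
     is_sequent P (Sequent \<kappa>s \<alpha> \<gamma>) \<and>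
     (\<forall>s \<kappa>s' \<alpha>'.
        belongs_to_system (\<kappa>s' @ [\<alpha>']) P \<and>
        multi_specialisation M s (\<kappa>s @ [\<alpha>]) (\<kappa>s' @ [\<alpha>']) \<and>
        instantiatable M (\<kappa>s' @ [\<alpha>']) \<longrightarrow>
        (\<exists>s' \<gamma>'.
           belongs_to \<gamma>' (meta_space P) \<and>
           (\<forall>x\<in>carrier (gUnion (set (\<kappa>s @ [\<alpha>]))). s' x = s x) \<and>
           multi_specialisation M s' (\<kappa>s @ [\<alpha> \<union>\<^sub>g \<gamma>]) (\<kappa>s' @ [\<alpha>' \<union>\<^sub>g \<gamma>']) \<and>
           instantiatable M (\<kappa>s' @ [\<alpha>' \<union>\<^sub>g \<gamma>'])))"

fun monotonic_for ::
  "('x, 'ty, 'co) multi_space \<Rightarrow> ('x, 'ty, 'co) multi_space \<Rightarrow>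
   ('x, 'ty, 'co) sequent \<Rightarrow> ('x, 'ty, 'co) graph list \<Rightarrow> ('x, 'ty, 'co) graph \<Rightarrow> bool" where
  "monotonic_for M P (Sequent \<kappa>s \<alpha> \<gamma>) \<kappa>s' \<alpha>' \<longleftrightarrow>
     schema M P (Sequent \<kappa>s \<alpha> \<gamma>) \<and> belongs_to_system (\<kappa>s' @ [\<alpha>']) P \<and>
     schema M P (Sequent (map2 (\<union>\<^sub>g) \<kappa>s \<kappa>s') (\<alpha> \<union>\<^sub>g \<alpha>') \<gamma>)"

fun weakening_map ::
  "('x, 'ty, 'co) multi_space \<Rightarrow> ('x, 'ty, 'co) multi_space \<Rightarrow> ('x \<rightharpoonup> 'x) \<Rightarrow>
   ('x, 'ty, 'co) sequent \<Rightarrow> ('x, 'ty, 'co) sequent \<Rightarrow> bool" where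
  "weakening_map M P r (Sequent \<kappa>s \<alpha> \<gamma>) (Sequent \<kappa>s' \<alpha>' \<gamma>') \<longleftrightarrow>
     is_sequent P (Sequent \<kappa>s \<alpha> \<gamma>) \<and> is_sequent P (Sequent \<kappa>s' \<alpha>' \<gamma>') \<and>
     dom r \<subseteq> carrier (gUnion (set (\<kappa>s @ [\<alpha> \<union>\<^sub>g \<gamma>]))) \<and>
     list_all2 (\<lambda>g h. pimage r g h \<subseteq>\<^sub>g h) (\<kappa>s @ [\<alpha> \<union>\<^sub>g \<gamma>]) (\<kappa>s' @ [\<alpha>' \<union>\<^sub>g \<gamma>']) \<and>
     carrier (gUnion (set (\<kappa>s @ [\<alpha>]))) \<subseteq> dom r \<and>
     multi_reification M (\<lambda>x. the (r x)) (\<kappa>s @ [\<alpha>]) (\<kappa>s' @ [\<alpha>']) \<and>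
     loosening_upto (tsys (meta_space M)) (cspec (meta_space M))
       (To (gUnion (set (\<kappa>s @ [\<alpha>]))) \<inter> To \<gamma>)
       (r |` carrier \<gamma>) \<gamma> (pimage r \<gamma> (\<alpha>' \<union>\<^sub>g \<gamma>'))"

text \<open>
  \<open>refinement_of M P S \<sigma>\<close>: the sequent \<open>\<sigma>\<close> is a refinement of the schema \<open>S\<close>. The codomain of
  the weakening map is itself given in terms of \<open>r[\<gamma>]\<close>, so that image is taken in the realm of
  the pattern meta-space, of which all pattern graphs for the meta-space are subgraphs.
\<close>

fun refinement_of ::
  "('x, 'ty, 'co) multi_space \<Rightarrow> ('x, 'ty, 'co) multi_space \<Rightarrow>
   ('x, 'ty, 'co) sequent \<Rightarrow> ('x, 'ty, 'co) sequent \<Rightarrow> bool" where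
  "refinement_of M P (Sequent \<kappa>s \<alpha> \<gamma>) (Sequent \<kappa>s' \<alpha>' \<gamma>') \<longleftrightarrow>
     schema M P (Sequent \<kappa>s \<alpha> \<gamma>) \<and> is_sequent P (Sequent \<kappa>s' \<alpha>' \<gamma>') \<and>
     (\<exists>r. let r\<gamma> = pimage r \<gamma> (realm (meta_space P)) in
        weakening_map M P r (Sequent \<kappa>s \<alpha> \<gamma>) (Sequent \<kappa>s' \<alpha>' r\<gamma>) \<and>
        monotonic_for M P (Sequent (map2 (pimage r) \<kappa>s \<kappa>s') (pimage r \<alpha> \<alpha>') r\<gamma>) \<kappa>s' \<alpha>' \<and>
        \<gamma>' \<subseteq>\<^sub>g \<alpha>' \<union>\<^sub>g r\<gamma>)"

text \<open>\<open>application_of M P S \<sigma> \<sigma>'\<close>: the sequent \<open>\<sigma>'\<close> is an application of the schema \<open>S\<close> to \<open>\<sigma>\<close>.\<close>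

fun application_of ::
  "('x, 'ty, 'co) multi_space \<Rightarrow> ('x, 'ty, 'co) multi_space \<Rightarrow>
   ('x, 'ty, 'co) sequent \<Rightarrow> ('x, 'ty, 'co) sequent \<Rightarrow> ('x, 'ty, 'co) sequent \<Rightarrow> bool" where
  "application_of M P S (Sequent \<kappa>s' \<alpha>' \<gamma>') \<sigma>' \<longleftrightarrow>
     is_sequent P \<sigma>' \<and>
     ((\<exists>\<delta>. \<sigma>' = Sequent \<kappa>s' (\<alpha>' \<union>\<^sub>g \<delta>) \<gamma>' \<and> refinement_of M P S (Sequent \<kappa>s' \<alpha>' \<delta>)) \<or>
      (\<exists>\<delta>. \<sigma>' = Sequent \<kappa>s' \<alpha>' \<delta> \<and> refinement_of M P S (Sequent \<kappa>s' (\<alpha>' \<union>\<^sub>g \<delta>) \<gamma>')))"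

inductive valid_over ::
  "('x, 'ty, 'co) multi_space \<Rightarrow> ('x, 'ty, 'co) multi_space \<Rightarrow>
   ('x, 'ty, 'co) sequent set \<Rightarrow> ('x, 'ty, 'co) sequent \<Rightarrow> bool"
  for M P :: "('x, 'ty, 'co) multi_space" and \<S> :: "('x, 'ty, 'co) sequent set" where
  schema_valid: "\<sigma> \<in> \<S> \<Longrightarrow> valid_over M P \<S> \<sigma>"
| application_valid:
    "is_sequent P \<sigma> \<Longrightarrow> S \<in> \<S> \<Longrightarrow> application_of M P S \<sigma> \<sigma>' \<Longrightarrow> valid_over M P \<S> \<sigma>' \<Longrightarrow>
     valid_over M P \<S> \<sigma>"

end

theory Submission
  imports Defs
begin

text \<open>
  Two rules suffice. (a) Weakening of the conclusion: if
  \<open>\<langle>\<kappa>s, \<alpha> \<tturnstile> \<delta>\<rangle>\<close> is a schema and \<open>\<gamma> \<subseteq> \<alpha> \<union> \<delta>\<close>, then so is \<open>\<langle>\<kappa>s, \<alpha> \<tturnstile> \<gamma>\<rangle>\<close>, since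
  the specialisation of \<open>\<alpha> \<union> \<delta>\<close> and its instantiation restrict to \<open>\<alpha> \<union> \<gamma>\<close>. (b) Cut: if
  \<open>\<langle>\<kappa>s, \<alpha> \<tturnstile> \<delta>\<rangle>\<close> and \<open>\<langle>\<kappa>s, \<alpha> \<union> \<delta> \<tturnstile> \<gamma>\<rangle>\<close> are schemas, then so is \<open>\<langle>\<kappa>s, \<alpha> \<tturnstile> \<gamma>\<rangle>\<close>.
  As \<open>r[\<kappa>\<^sub>i] \<subseteq> \<kappa>\<^sub>i'\<close> and \<open>r[\<alpha>] \<subseteq> \<alpha>'\<close>, monotonicity says that \<open>\<langle>\<kappa>s', \<alpha>' \<tturnstile> r[\<gamma>]\<rangle>\<close> is a schema,
  so refinements are schemas by (a), and both kinds of application are instances of (b).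

  The restrictions in (a) exist because a structure graph contained in another one contains,
  for each of its constructors, all arrows incident with it: their number is prescribed
  by the signature.
\<close>

section \<open>Structure subgraphs\<close>

lemma app_eq: "single_valued r \<Longrightarrow> (x, y) \<in> r \<Longrightarrow> app r x = y"
  unfolding app_def by (blast intro: the_equality dest: single_valuedD)

lemma app_mono:
  assumes "single_valued r" "q \<subseteq> r" "x \<in> Domain q"
  shows "app q x = app r x"
proof -
  obtain y where "(x, y) \<in> q" using assms(3) by blast
  then show ?thesis
    using app_eq[of q x y] app_eq[of r x y] assms single_valued_subset[of q r] by auto
qed

lemma single_valued_restrict: "single_valued r \<Longrightarrow> single_valued {(x, y) \<in> r. x \<in> A}"
  by (auto simp: single_valued_def)

lemma Domain_restrict: "A \<subseteq> Domain r \<Longrightarrow> Domain {(x, y) \<in> r. x \<in> A} = A"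
  by auto

text \<open>Single-valuedness leaves \<open>r\<close> no second value on \<open>A\<close>. This
  recovers the labels of a subgraph from those of the ambient graph.\<close>

lemma restrict_Domain_eq:
  assumes "single_valued r" "q \<subseteq> r" "Domain q = A"
  shows "{(x, y) \<in> r. x \<in> A} = q"
  using assms by (auto dest: single_valuedD)

section \<open>Inclusion and union of graphs\<close>

lemma subgraph_trans: "f \<subseteq>\<^sub>g g \<Longrightarrow> g \<subseteq>\<^sub>g h \<Longrightarrow> f \<subseteq>\<^sub>g h"
  by (auto simp: subgraph_def)

lemma subgraph_gunion1: "g \<subseteq>\<^sub>g g \<union>\<^sub>g h" and subgraph_gunion2: "h \<subseteq>\<^sub>g g \<union>\<^sub>g h"
  by (auto simp: subgraph_def gUnion_def)

lemma subgraph_gUnion: "g \<in> X \<Longrightarrow> g \<subseteq>\<^sub>g gUnion X"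
  by (auto simp: subgraph_def gUnion_def)

lemma gunion_subgraph: "g \<subseteq>\<^sub>g k \<Longrightarrow> h \<subseteq>\<^sub>g k \<Longrightarrow> g \<union>\<^sub>g h \<subseteq>\<^sub>g k"
  by (auto simp: subgraph_def gUnion_def)

lemma gunion_absorb: "g \<subseteq>\<^sub>g h \<Longrightarrow> g \<union>\<^sub>g h = h"
  by (intro graph.equality) (auto simp: subgraph_def gUnion_def)

lemma gunion_assoc: "(f \<union>\<^sub>g g) \<union>\<^sub>g h = f \<union>\<^sub>g (g \<union>\<^sub>g h)"
  by (simp add: gUnion_def Un_assoc)

lemma specialisation_dest:
  assumes "specialisation T C s g h"
  shows "structure_graph T C g" "structure_graph T C h" "isomorphism s g h" "homomorphism s g h"
  using assms by (simp_all add: specialisation_upto_def isomorphism_def)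

section \<open>Labels and incidence in graphs and their subgraphs\<close>

lemma structure_graph_is_graph: "structure_graph T C g \<Longrightarrow> is_graph g"
  by (simp add: structure_graph_def)

lemma app_tok_type_subgraph:
  assumes "is_graph g" "is_graph h" "g \<subseteq>\<^sub>g h" "t \<in> To g"
  shows "app (tok_type g) t = app (tok_type h) t"
  using assms by (intro app_mono) (auto simp: is_graph_def function_on_def subgraph_def)

lemma app_con_label_subgraph:
  assumes "is_graph g" "is_graph h" "g \<subseteq>\<^sub>g h" "u \<in> Cr g"
  shows "app (con_label g) u = app (con_label h) u"
  using assms by (intro app_mono) (auto simp: is_graph_def function_on_def subgraph_def)

lemma iv_cases:
  assumes "is_graph g" "(a, u, v) \<in> iv g"
  shows "a \<in> Arr g" "u \<in> To g \<and> v \<in> Cr g \<or> u \<in> Cr g \<and> v \<in> To g"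
  using assms by (auto simp: is_graph_def function_on_def)

lemma arrow_iv:
  assumes "is_graph g" "a \<in> Arr g"
  obtains u v where "(a, u, v) \<in> iv g"
proof -
  have "a \<in> Domain (iv g)" using assms by (simp add: is_graph_def function_on_def)
  then show thesis using that by auto
qed

lemma iv_unique:
  assumes "is_graph g" "(a, p) \<in> iv g" "(a, q) \<in> iv g"
  shows "p = q"
  using assms unfolding is_graph_def function_on_def single_valued_def by blast

text \<open>The clause of \<open>structure_graph\<close> about a constructor is an implication from
  a signature entry. Labels lie in \<open>Co C\<close>, the domain of \<open>sig C\<close>, so an
  entry always exists and the clause is never vacuous.\<close>

lemma structure_graph_cons:
  assumes "is_cons_spec T C" "structure_graph T C g" "u \<in> Cr g"
  obtains \<tau>s \<tau> where "(app (con_label g) u, \<tau>s, \<tau>) \<in> sig C"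
proof -
  have "u \<in> Domain (con_label g)" and sv: "single_valued (con_label g)"
    using assms(2,3) by (auto simp: structure_graph_def is_graph_def function_on_def)
  then obtain c where c: "(u, c) \<in> con_label g" by blast
  then have "c \<in> Domain (sig C)"
    using assms(1,2) by (auto simp: structure_graph_def is_cons_spec_def function_on_def)
  then show thesis using that app_eq[OF sv c] by auto
qed

text \<open>The label of \<open>u\<close> is the same in \<open>g\<close> and \<open>h\<close>, so
  both graphs give \<open>u\<close> one outgoing arrow and the same finite number of incoming ones.
  The inclusions between these sets of arrows are therefore equalities.\<close>

lemma structure_graph_incident_closed:
  assumes C: "is_cons_spec T C" and g: "structure_graph T C g" and h: "structure_graph T C h"
    and sub: "g \<subseteq>\<^sub>g h" and u: "u \<in> Cr g"
  shows "(a, v, u) \<in> iv h \<Longrightarrow> (a, v, u) \<in> iv g" "(a, u, v) \<in> iv h \<Longrightarrow> (a, u, v) \<in> iv g"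
proof -
  obtain \<tau>s \<tau> where sg: "(app (con_label g) u, \<tau>s, \<tau>) \<in> sig C"
    using structure_graph_cons[OF C g u] .
  have gg: "is_graph g" "is_graph h" using g h by (auto simp: structure_graph_def)
  have sh: "(app (con_label h) u, \<tau>s, \<tau>) \<in> sig C"
    using sg app_con_label_subgraph[OF gg sub u] by simp
  have uh: "u \<in> Cr h" using u sub by (auto simp: subgraph_def)
  have sv: "single_valued (iv h)" using gg by (simp add: is_graph_def function_on_def)
  have ivs: "iv g \<subseteq> iv h" using sub by (simp add: subgraph_def)
  have bg: "bij_betw (app (idx g)) (incoming g u) {1..length \<tau>s}"
    and og: "\<exists>a. outgoing g u = {a}"
    using g sg u unfolding structure_graph_def by blast+
  have bh: "bij_betw (app (idx h)) (incoming h u) {1..length \<tau>s}"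
    and oh: "\<exists>a. outgoing h u = {a}"
    using h sh uh unfolding structure_graph_def by blast+
  have "incoming g u \<subseteq> incoming h u" "outgoing g u \<subseteq> outgoing h u"
    using ivs by (auto simp: incoming_def outgoing_def)
  moreover have "finite (incoming h u)" using bij_betw_finite[OF bh] by simp
  moreover have "card (incoming g u) = card (incoming h u)"
    using bij_betw_same_card[OF bg] bij_betw_same_card[OF bh] by simp
  ultimately have eq: "incoming g u = incoming h u" "outgoing g u = outgoing h u"
    using og oh by (simp_all add: card_subset_eq) auto
  {
    assume a: "(a, v, u) \<in> iv h"
    then have "a \<in> incoming g u" using eq by (auto simp: incoming_def)
    then obtain w where "(a, w, u) \<in> iv g" by (auto simp: incoming_def)
    \<comment> \<open>The arrow is now known to enter \<open>u\<close> in \<open>g\<close> from some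
      \<open>w\<close>; uniqueness of incidence in \<open>h\<close> forces
      \<open>w = v\<close>.\<close>
    then show "(a, v, u) \<in> iv g" using a ivs single_valuedD[OF sv a, of "(w, u)"] by auto
  }
  {
    assume a: "(a, u, v) \<in> iv h"
    then have "a \<in> outgoing g u" using eq by (auto simp: outgoing_def)
    then obtain w where "(a, u, w) \<in> iv g" by (auto simp: outgoing_def)
    then show "(a, u, v) \<in> iv g" using a ivs single_valuedD[OF sv a, of "(u, w)"] by auto
  }
qed

text \<open>Every arrow has a constructor at one end. If it is the target, the arrow is already
  indexed in \<open>g\<close>, and \<open>h\<close> allows only one index. If it is the source, the
  arrow has no index in \<open>h\<close>, against the assumption.\<close>

lemma structure_graph_idx_closed:
  assumes C: "is_cons_spec T C" and g: "structure_graph T C g" and h: "structure_graph T C h"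
    and sub: "g \<subseteq>\<^sub>g h" and i: "(a, i) \<in> idx h" and a: "a \<in> Arr g"
  shows "(a, i) \<in> idx g"
proof -
  have gg: "is_graph g" "is_graph h" using g h by (auto simp: structure_graph_def)
  obtain u v where uv: "(a, u, v) \<in> iv g"
    using arrow_iv[OF gg(1) a] .
  consider "v \<in> Cr g" | "u \<in> Cr g" using iv_cases[OF gg(1) uv] by blast
  then show ?thesis
  proof cases
    case 1
    obtain \<tau>s \<tau> where "(app (con_label g) v, \<tau>s, \<tau>) \<in> sig C"
      using structure_graph_cons[OF C g 1] .
    then have "incoming g v \<subseteq> Domain (idx g)" using g 1 unfolding structure_graph_def by blast
    moreover have "a \<in> incoming g v" using uv by (auto simp: incoming_def)
    ultimately obtain j where j: "(a, j) \<in> idx g" by blast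
    then have "(a, j) \<in> idx h" using sub by (auto simp: subgraph_def)
    then have "j = i" using i gg(2) by (auto simp: is_graph_def dest: single_valuedD)
    then show ?thesis using j by simp
  next
    case 2
    then have u: "u \<in> Cr h" using sub by (auto simp: subgraph_def)
    obtain \<tau>s \<tau> where "(app (con_label h) u, \<tau>s, \<tau>) \<in> sig C"
      using structure_graph_cons[OF C h u] .
    then obtain b where "outgoing h u = {b}" "b \<notin> Domain (idx h)"
      using h u unfolding structure_graph_def by blast
    moreover have "a \<in> outgoing h u" using uv sub by (auto simp: outgoing_def subgraph_def)
    ultimately show ?thesis using i by auto
  qed
qed

text \<open>The conditions on a constructor are local: they speak only of its incident arrows, their
  indices and the tokens at their other ends. A subgraph that keeps all of these inherits the
  conditions.\<close>

lemma structure_graph_subgraph: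
  assumes h: "structure_graph T C h" and g: "is_graph g" and sub: "g \<subseteq>\<^sub>g h"
    and inc: "\<And>u a v. u \<in> Cr g \<Longrightarrow> (a, v, u) \<in> iv h \<Longrightarrow> (a, v, u) \<in> iv g"
    and out: "\<And>u a v. u \<in> Cr g \<Longrightarrow> (a, u, v) \<in> iv h \<Longrightarrow> (a, u, v) \<in> iv g"
    and idx: "\<And>a i. a \<in> Arr g \<Longrightarrow> (a, i) \<in> idx h \<Longrightarrow> (a, i) \<in> idx g"
  shows "structure_graph T C g"
proof -
  have gh: "is_graph h" using h by (simp add: structure_graph_def)
  have "Range (tok_type g) \<subseteq> types T" "Range (con_label g) \<subseteq> Co C"
    using h sub Range_mono[of "tok_type g" "tok_type h"] Range_mono[of "con_label g" "con_label h"]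
    unfolding structure_graph_def subgraph_def by (meson order_trans)+
  moreover have "(\<exists>a t. outgoing g u = {a} \<and> a \<notin> Domain (idx g) \<and>
           (a, u, t) \<in> iv g \<and> (app (tok_type g) t, \<tau>) \<in> ty_le T) \<and>
        incoming g u \<noteq> {} \<and> incoming g u \<subseteq> Domain (idx g) \<and>
        bij_betw (app (idx g)) (incoming g u) {1..length \<tau>s} \<and>
        (\<forall>a t. (a, t, u) \<in> iv g \<longrightarrow>
           (app (tok_type g) t, \<tau>s ! (app (idx g) a - 1)) \<in> ty_le T)"
    if u: "u \<in> Cr g" and sg: "(app (con_label g) u, \<tau>s, \<tau>) \<in> sig C" for u \<tau>s \<tau>
  proof -
    have uh: "u \<in> Cr h" using u sub by (auto simp: subgraph_def)
    have "(app (con_label h) u, \<tau>s, \<tau>) \<in> sig C"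
      using sg app_con_label_subgraph[OF g gh sub u] by simp
    with h uh have H: "(\<exists>a t. outgoing h u = {a} \<and> a \<notin> Domain (idx h) \<and>
           (a, u, t) \<in> iv h \<and> (app (tok_type h) t, \<tau>) \<in> ty_le T) \<and>
        incoming h u \<noteq> {} \<and> incoming h u \<subseteq> Domain (idx h) \<and>
        bij_betw (app (idx h)) (incoming h u) {1..length \<tau>s} \<and>
        (\<forall>a t. (a, t, u) \<in> iv h \<longrightarrow>
           (app (tok_type h) t, \<tau>s ! (app (idx h) a - 1)) \<in> ty_le T)"
      unfolding structure_graph_def by blast
    have ivs: "iv g \<subseteq> iv h" and idxs: "idx g \<subseteq> idx h" using sub by (auto simp: subgraph_def)
    have eq: "incoming g u = incoming h u" "outgoing g u = outgoing h u"
      using inc[OF u] out[OF u] ivs unfolding incoming_def outgoing_def by blast+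
    have arr: "a \<in> Arr g" if "a \<in> incoming g u" for a
      using that g by (auto simp: incoming_def dest: iv_cases)
    have dom: "incoming g u \<subseteq> Domain (idx g)" using H eq arr idx by blast
    have svh: "single_valued (idx h)" using gh by (simp add: is_graph_def)
    have appi: "app (idx g) a = app (idx h) a" if "a \<in> incoming g u" for a
      using app_mono[OF svh idxs] dom that by blast
    have tok: "app (tok_type g) t = app (tok_type h) t"
      if "(a, u, t) \<in> iv g \<or> (a, t, u) \<in> iv g" for a t
    proof -
      \<comment> \<open>Arrows join vertices of different classes and \<open>u\<close> is a
        constructor, so the other end is a token.\<close>
      have "t \<in> To g" using that u iv_cases(2)[OF g] g by (fastforce simp: is_graph_def)
      then show ?thesis by (rule app_tok_type_subgraph[OF g gh sub])
    qed
    have "\<exists>a t. outgoing g u = {a} \<and> a \<notin> Domain (idx g) \<and>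
           (a, u, t) \<in> iv g \<and> (app (tok_type g) t, \<tau>) \<in> ty_le T"
    proof -
      obtain a t where at: "outgoing h u = {a}" "a \<notin> Domain (idx h)"
        "(a, u, t) \<in> iv h" "(app (tok_type h) t, \<tau>) \<in> ty_le T" using H by blast
      then have "(a, u, t) \<in> iv g" using out[OF u] by blast
      then show ?thesis using at eq idxs tok by (metis Domain_mono subsetD)
    qed
    moreover have "bij_betw (app (idx g)) (incoming g u) {1..length \<tau>s}"
      using H eq appi by (metis bij_betw_cong)
    moreover have "(app (tok_type g) t, \<tau>s ! (app (idx g) a - 1)) \<in> ty_le T"
      if at: "(a, t, u) \<in> iv g" for a t
    proof -
      have "a \<in> incoming g u" using at by (auto simp: incoming_def)
      moreover have "(a, t, u) \<in> iv h" using at ivs by blast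
      ultimately show ?thesis using H appi tok at by metis
    qed
    ultimately show ?thesis using H eq dom by auto
  qed
  ultimately show ?thesis unfolding structure_graph_def using g by blast
qed

text \<open>The common supergraph \<open>k\<close> makes \<open>g\<close> and \<open>h\<close>
  compatible. A constructor that they share gains no arrows in the union, since each of them already
  contains all arrows of \<open>k\<close> incident with its constructors.\<close>

lemma structure_graph_gunion:
  assumes C: "is_cons_spec T C" and k: "structure_graph T C k"
    and g: "structure_graph T C g" and h: "structure_graph T C h"
    and sub: "g \<subseteq>\<^sub>g k" "h \<subseteq>\<^sub>g k"
  shows "structure_graph T C (g \<union>\<^sub>g h)"
proof (rule structure_graph_subgraph[OF k])
  show s: "g \<union>\<^sub>g h \<subseteq>\<^sub>g k" using sub by (rule gunion_subgraph)
  have "is_graph k" "is_graph g" "is_graph h"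
    using k g h by (auto simp: structure_graph_def)
  \<comment> \<open>Disjointness and single-valuedness are inherited from \<open>k\<close>; the
    domain and range conditions that follow come from \<open>g\<close> and \<open>h\<close>
    separately.\<close>
  then have "To (g \<union>\<^sub>g h) \<inter> Cr (g \<union>\<^sub>g h) = {}"
    "Arr (g \<union>\<^sub>g h) \<inter> (To (g \<union>\<^sub>g h) \<union> Cr (g \<union>\<^sub>g h)) = {}"
    "single_valued (iv (g \<union>\<^sub>g h))" "single_valued (idx (g \<union>\<^sub>g h))"
    "single_valued (tok_type (g \<union>\<^sub>g h))" "single_valued (con_label (g \<union>\<^sub>g h))"
    using s by (auto simp: is_graph_def function_on_def subgraph_def intro: single_valued_subset)
  moreover have "Domain (iv (g \<union>\<^sub>g h)) = Arr (g \<union>\<^sub>g h)"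
    "Domain (tok_type (g \<union>\<^sub>g h)) = To (g \<union>\<^sub>g h)"
    "Domain (con_label (g \<union>\<^sub>g h)) = Cr (g \<union>\<^sub>g h)"
    "Domain (idx (g \<union>\<^sub>g h)) \<subseteq> Arr (g \<union>\<^sub>g h)"
    using \<open>is_graph g\<close> \<open>is_graph h\<close>
    by (simp_all add: is_graph_def function_on_def gUnion_def Domain_Un_eq) blast
  moreover have "Range (iv (g \<union>\<^sub>g h)) \<subseteq>
      To (g \<union>\<^sub>g h) \<times> Cr (g \<union>\<^sub>g h) \<union> Cr (g \<union>\<^sub>g h) \<times> To (g \<union>\<^sub>g h)"
    using \<open>is_graph g\<close> \<open>is_graph h\<close> by (simp add: is_graph_def gUnion_def) blast
  ultimately show "is_graph (g \<union>\<^sub>g h)" unfolding is_graph_def function_on_def by blast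
next
  fix u a v assume "u \<in> Cr (g \<union>\<^sub>g h)"
  then have u: "u \<in> Cr g \<or> u \<in> Cr h" by (simp add: gUnion_def)
  show "(a, v, u) \<in> iv k \<Longrightarrow> (a, v, u) \<in> iv (g \<union>\<^sub>g h)"
    using u structure_graph_incident_closed(1)[OF C g k sub(1)]
      structure_graph_incident_closed(1)[OF C h k sub(2)] by (auto simp: gUnion_def)
  show "(a, u, v) \<in> iv k \<Longrightarrow> (a, u, v) \<in> iv (g \<union>\<^sub>g h)"
    using u structure_graph_incident_closed(2)[OF C g k sub(1)]
      structure_graph_incident_closed(2)[OF C h k sub(2)] by (auto simp: gUnion_def)
next
  fix a i assume "a \<in> Arr (g \<union>\<^sub>g h)" "(a, i) \<in> idx k"
  then show "(a, i) \<in> idx (g \<union>\<^sub>g h)"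
    using structure_graph_idx_closed[OF C g k sub(1)]
      structure_graph_idx_closed[OF C h k sub(2)] by (auto simp: gUnion_def)
qed

lemma belongs_to_gunion:
  assumes "construction_space X" "belongs_to g X" "belongs_to h X"
  shows "belongs_to (g \<union>\<^sub>g h) X"
  using assms structure_graph_gunion[of "tsys X" "cspec X" "realm X" g h] gunion_subgraph
  by (auto simp: belongs_to_def construction_space_def)


section \<open>Restriction of specialisation functions\<close>

lemma gimage_sel [simp]:
  "To (gimage f g h) = f ` To g" "Cr (gimage f g h) = f ` Cr g"
  "Arr (gimage f g h) = f ` Arr g"
  "iv (gimage f g h) = {(a, p) \<in> iv h. a \<in> f ` Arr g}"
  "idx (gimage f g h) = {(a, i) \<in> idx h. a \<in> f ` Arr g}"
  "tok_type (gimage f g h) = {(t, \<tau>) \<in> tok_type h. t \<in> f ` To g}"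
  "con_label (gimage f g h) = {(u, c) \<in> con_label h. u \<in> f ` Cr g}"
  by (auto simp: pimage_def Let_def)

lemma gimage_subgraph: "homomorphism f g h \<Longrightarrow> gimage f g h \<subseteq>\<^sub>g h"
  unfolding homomorphism_def subgraph_def gimage_sel by auto

lemma gimage_gunion: "gimage f (g \<union>\<^sub>g h) k = gimage f g k \<union>\<^sub>g gimage f h k"
  by (rule graph.equality) (auto simp: gUnion_def)

lemma homomorphism_subgraph: "homomorphism f g h \<Longrightarrow> e \<subseteq>\<^sub>g g \<Longrightarrow> homomorphism f e h"
  by (simp add: homomorphism_def subgraph_def subset_eq)

lemma homomorphism_image:
  assumes "homomorphism f g h"
  shows "f ` To g \<subseteq> To h" "f ` Cr g \<subseteq> Cr h" "f ` Arr g \<subseteq> Arr h"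
  using assms by (simp_all add: homomorphism_def)

text \<open>Each class is mapped into its counterpart and together the images cover
  \<open>carrier h\<close>. As the classes of \<open>h\<close> are disjoint, none of the three
  inclusions can be proper.\<close>

lemma isomorphism_components:
  assumes "is_graph g" "is_graph h" "isomorphism f g h"
  shows "f ` To g = To h" "f ` Cr g = Cr h" "f ` Arr g = Arr h"
proof -
  have "homomorphism f g h" and "f ` carrier g = carrier h"
    using assms(3) by (simp_all add: isomorphism_def bij_betw_def)
  then have im: "f ` To g \<subseteq> To h" "f ` Cr g \<subseteq> Cr h" "f ` Arr g \<subseteq> Arr h"
    and c: "f ` To g \<union> f ` Cr g \<union> f ` Arr g = To h \<union> Cr h \<union> Arr h"
    by (simp_all add: homomorphism_image carrier_def image_Un)
  have disj: "To h \<inter> Cr h = {}" "Arr h \<inter> (To h \<union> Cr h) = {}"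
    using assms(2) by (simp_all add: is_graph_def)
  have "A = A' \<and> B = B' \<and> D = D'"
    if "A \<subseteq> A'" "B \<subseteq> B'" "D \<subseteq> D'" "A \<union> B \<union> D = A' \<union> B' \<union> D'"
      "A' \<inter> B' = {}" "D' \<inter> (A' \<union> B') = {}" for A A' B B' D D' :: "'a set"
    using that by blast
  from this[OF im c disj] show "f ` To g = To h" "f ` Cr g = Cr h" "f ` Arr g = Arr h"
    by simp_all
qed

text \<open>The image takes its incidence from \<open>h\<close>, so the point to check is that the
  ends of an image arrow are in the image too. They are, because \<open>f a\<close> has a single
  pair of ends in \<open>h\<close>, namely the images of the ends of \<open>a\<close>.\<close>

lemma is_graph_gimage:
  assumes g: "is_graph g" and h: "is_graph h" and f: "homomorphism f g h"
  shows "is_graph (gimage f g h)"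
proof -
  have im: "f ` To g \<subseteq> To h" "f ` Cr g \<subseteq> Cr h" "f ` Arr g \<subseteq> Arr h"
    using homomorphism_image[OF f] by simp_all
  have H: "To h \<inter> Cr h = {}" "Arr h \<inter> (To h \<union> Cr h) = {}" "single_valued (iv h)"
    "Domain (iv h) = Arr h" "single_valued (idx h)" "single_valued (tok_type h)"
    "Domain (tok_type h) = To h" "single_valued (con_label h)" "Domain (con_label h) = Cr h"
    using h by (simp_all add: is_graph_def function_on_def)
  have rng: "p \<in> f ` To g \<times> f ` Cr g \<union> f ` Cr g \<times> f ` To g"
    if p: "(f a, p) \<in> iv h" and a: "a \<in> Arr g" for a p
  proof -
    obtain u v where uv: "(a, u, v) \<in> iv g"
      using arrow_iv[OF g a] .
    then have "(f a, f u, f v) \<in> iv h" using f by (auto simp: homomorphism_def)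
    then have "p = (f u, f v)" using iv_unique[OF h p] by simp
    then show ?thesis using iv_cases(2)[OF g uv] by auto
  qed
  have "single_valued (iv (gimage f g h))" "single_valued (idx (gimage f g h))"
    "single_valued (tok_type (gimage f g h))" "single_valued (con_label (gimage f g h))"
    using H(3,5,6,8) by (simp_all add: single_valued_restrict)
  moreover have "Domain (iv (gimage f g h)) = f ` Arr g"
    "Domain (tok_type (gimage f g h)) = f ` To g"
    "Domain (con_label (gimage f g h)) = f ` Cr g"
    using im H(4,7,9) by (simp_all only: gimage_sel Domain_restrict)
  moreover have "Range (iv (gimage f g h)) \<subseteq> f ` To g \<times> f ` Cr g \<union> f ` Cr g \<times> f ` To g"
    using rng by auto
  moreover have "f ` To g \<inter> f ` Cr g = {}" "f ` Arr g \<inter> (f ` To g \<union> f ` Cr g) = {}"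
    using im H(1,2) by blast+
  moreover have "Domain (idx (gimage f g h)) \<subseteq> f ` Arr g" by auto
  ultimately show ?thesis unfolding is_graph_def function_on_def gimage_sel(1-3) by blast
qed

lemma homomorphism_codomain_mono: "homomorphism f g h \<Longrightarrow> h \<subseteq>\<^sub>g k \<Longrightarrow> homomorphism f g k"
  by (simp add: homomorphism_def subgraph_def subset_iff)

lemma homomorphism_gUnion:
  assumes "\<And>g. g \<in> X \<Longrightarrow> homomorphism f g h"
  shows "homomorphism f (gUnion X) h"
proof -
  have "f ` To g \<subseteq> To h" "f ` Cr g \<subseteq> Cr h" "f ` Arr g \<subseteq> Arr h"
    "\<And>a u v. (a, u, v) \<in> iv g \<Longrightarrow> (f a, f u, f v) \<in> iv h" if "g \<in> X" for g
    using assms[OF that] by (simp_all add: homomorphism_def)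
  note X = this
  show ?thesis
    unfolding homomorphism_def
  proof (intro conjI allI impI)
    show "f ` To (gUnion X) \<subseteq> To h" "f ` Cr (gUnion X) \<subseteq> Cr h" "f ` Arr (gUnion X) \<subseteq> Arr h"
      using X(1-3) by (simp_all add: gUnion_def image_UN UN_subset_iff)
    fix a u v assume "(a, u, v) \<in> iv (gUnion X)"
    then obtain g where "g \<in> X" "(a, u, v) \<in> iv g" by (auto simp: gUnion_def)
    then show "(f a, f u, f v) \<in> iv h" by (rule X(4))
  qed
qed

text \<open>Passing from \<open>k\<close> to \<open>h\<close> changes only where incidence and
  labels are read off; those of the left graph lie in \<open>h\<close> and concern the image of
  \<open>g\<close>.\<close>

lemma gimage_subgraph_gimage: "gimage f g k \<subseteq>\<^sub>g h \<Longrightarrow> gimage f g k \<subseteq>\<^sub>g gimage f g h"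
  by (simp add: subgraph_def subset_iff)

text \<open>The crux is that the image of \<open>e\<close> is again a structure graph, that is,
  closed under incident arrows in \<open>h\<close>. Such an arrow is pulled back to \<open>g\<close>
  by surjectivity of \<open>s\<close>, and closure of \<open>e\<close> in \<open>g\<close> then
  applies.\<close>

lemma specialisation_restrict:
  assumes C: "is_cons_spec T C" and s: "specialisation T C s g h"
    and e: "structure_graph T C e" and sub: "e \<subseteq>\<^sub>g g"
  shows "specialisation T C s e (gimage s e h)"
proof -
  have g: "structure_graph T C g" and h: "structure_graph T C h" and iso: "isomorphism s g h"
    using specialisation_dest[OF s] by blast+
  note gg = g[THEN structure_graph_is_graph] and gh = h[THEN structure_graph_is_graph]
    and ge = e[THEN structure_graph_is_graph]
  have hom: "homomorphism s g h" and inj: "inj_on s (carrier g)"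
    using iso by (auto simp: isomorphism_def bij_betw_def)
  have home: "homomorphism s e h" using homomorphism_subgraph[OF hom sub] .
  have gi: "is_graph (gimage s e h)" using is_graph_gimage[OF ge gh home] .
  have subi: "gimage s e h \<subseteq>\<^sub>g h" using gimage_subgraph[OF home] .
  have ces: "carrier e \<subseteq> carrier g" using sub by (auto simp: carrier_def subgraph_def)
  have inc: "a' \<in> s ` Arr e"
    if u': "u' \<in> s ` Cr e" and a': "(a', v', u') \<in> iv h \<or> (a', u', v') \<in> iv h" for a' u' v'
  proof -
    obtain u where u: "u \<in> Cr e" "u' = s u" using u' by blast
    have "a' \<in> s ` Arr g"
      using a' iv_cases(1)[OF gh] isomorphism_components(3)[OF gg gh iso] by blast
    then obtain a where a: "a \<in> Arr g" "a' = s a" by blast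
    obtain v w where vw: "(a, v, w) \<in> iv g"
      using arrow_iv[OF gg a(1)] .
    have "(s a, s v, s w) \<in> iv h" using vw hom by (auto simp: homomorphism_def)
    \<comment> \<open>The ends of \<open>s a\<close> in \<open>h\<close> are unique, so
      \<open>u'\<close> is the image of an end of \<open>a\<close>; injectivity of \<open>s\<close>
      will identify that end with \<open>u\<close>.\<close>
    then have "u' = s v \<or> u' = s w"
      using a' a(2) iv_unique[OF gh] by blast
    moreover have "v \<in> carrier g" "w \<in> carrier g" "u \<in> carrier g"
      using iv_cases(2)[OF gg vw] u ces by (auto simp: carrier_def)
    ultimately have "u = v \<or> u = w" using u inj by (auto dest: inj_onD)
    then have "(a, v, w) \<in> iv e"
      using structure_graph_incident_closed[OF C e g sub u(1)] vw by blast
    then show ?thesis using a(2) iv_cases(1)[OF ge] by blast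
  qed
  have st: "structure_graph T C (gimage s e h)"
    by (rule structure_graph_subgraph[OF h gi subi]) (auto intro: inc)
  have "homomorphism s e (gimage s e h)"
    using home iv_cases(1)[OF ge] by (auto simp: homomorphism_def)
  moreover have "bij_betw s (carrier e) (carrier (gimage s e h))"
    using inj_on_subset[OF inj ces] by (auto simp: bij_betw_def carrier_def)
  ultimately have "isomorphism s e (gimage s e h)" by (simp add: isomorphism_def)
  moreover have "app (con_label (gimage s e h)) (s u) = app (con_label e) u" if "u \<in> Cr e" for u
  proof -
    have "u \<in> Cr g" using that sub by (auto simp: subgraph_def)
    then have "app (con_label h) (s u) = app (con_label g) u"
      using s by (auto simp: specialisation_upto_def)
    then show ?thesis
      using app_con_label_subgraph[OF ge gg sub that]
        app_con_label_subgraph[OF gi gh subi, of "s u"] that by simp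
  qed
  moreover have "(app (tok_type (gimage s e h)) (s t), app (tok_type e) t) \<in> ty_le T"
    if "t \<in> To e" for t
  proof -
    have "t \<in> To g" using that sub by (auto simp: subgraph_def)
    then have "(app (tok_type h) (s t), app (tok_type g) t) \<in> ty_le T"
      using s by (auto simp: specialisation_upto_def)
    then show ?thesis
      using app_tok_type_subgraph[OF ge gg sub that]
        app_tok_type_subgraph[OF gi gh subi, of "s t"] that by simp
  qed
  ultimately show ?thesis using e st by (simp add: specialisation_upto_def)
qed

text \<open>Needed when \<open>s'\<close> extends \<open>s\<close> to a larger graph with codomain
  \<open>k\<close>: the old codomain \<open>h\<close> is still the image of the old domain
  \<open>g\<close>.\<close>

lemma specialisation_gimage_eq:
  assumes C: "is_cons_spec T C" and s: "specialisation T C s g h"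
    and k: "structure_graph T C k" and sub: "h \<subseteq>\<^sub>g k"
    and eq: "\<And>x. x \<in> carrier g \<Longrightarrow> s' x = s x"
  shows "gimage s' g k = h"
proof -
  have g: "structure_graph T C g" and h: "structure_graph T C h" and iso: "isomorphism s g h"
    using specialisation_dest[OF s] by blast+
  note gg = g[THEN structure_graph_is_graph] and gh = h[THEN structure_graph_is_graph]
    and gk = k[THEN structure_graph_is_graph]
  have "s' ` To g = s ` To g" "s' ` Cr g = s ` Cr g" "s' ` Arr g = s ` Arr g"
    using eq by (auto simp: carrier_def intro!: image_cong)
  then have im: "s' ` To g = To h" "s' ` Cr g = Cr h" "s' ` Arr g = Arr h"
    using isomorphism_components[OF gg gh iso] by simp_all
  have "{(a, p) \<in> iv k. a \<in> Arr h} = iv h" "{(t, \<tau>) \<in> tok_type k. t \<in> To h} = tok_type h"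
    "{(u, c) \<in> con_label k. u \<in> Cr h} = con_label h"
    using gh gk sub
    by (simp_all add: is_graph_def function_on_def subgraph_def restrict_Domain_eq)
  \<comment> \<open>Indices are partial, so equality of domains cannot be used here as for the other
    components; closure of structure subgraphs under indices replaces it.\<close>
  moreover have "{(a, i) \<in> idx k. a \<in> Arr h} = idx h"
  proof -
    have "idx h \<subseteq> idx k" "Domain (idx h) \<subseteq> Arr h"
      using sub gh by (simp_all add: subgraph_def is_graph_def)
    then show ?thesis using structure_graph_idx_closed[OF C h k sub] by blast
  qed
  ultimately show ?thesis
    using im by (intro graph.equality) (simp_all only: gimage_sel, simp)
qed

section \<open>Specialisation and instantiation of tuples\<close>

lemma multi_specialisation_dest:
  assumes "multi_specialisation M s gs hs"
  shows "length gs = length (all_spaces M)" "length hs = length gs"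
    "\<And>i. i < length gs \<Longrightarrow> specialisation (tsys (all_spaces M ! i)) (cspec (all_spaces M ! i))
       s (gs ! i) (hs ! i)"
    "\<And>i. i < length gs \<Longrightarrow> gimage s (gs ! i) (gUnion (set hs)) \<subseteq>\<^sub>g hs ! i"
proof -
  have t: "tuple_homomorphism s gs hs"
    and "length gs = length (all_spaces M)"
    and "\<forall>i<length gs. specialisation (tsys (all_spaces M ! i)) (cspec (all_spaces M ! i))
       s (gs ! i) (hs ! i)"
    using assms unfolding multi_specialisation_def by blast+
  then show "length gs = length (all_spaces M)"
    "\<And>i. i < length gs \<Longrightarrow> specialisation (tsys (all_spaces M ! i)) (cspec (all_spaces M ! i))
       s (gs ! i) (hs ! i)" by blast+
  have "length gs = length hs"
    and "\<forall>i<length gs. gimage s (gs ! i) (gUnion (set hs)) \<subseteq>\<^sub>g hs ! i"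
    using t unfolding tuple_homomorphism_def by blast+
  then show "length hs = length gs"
    "\<And>i. i < length gs \<Longrightarrow> gimage s (gs ! i) (gUnion (set hs)) \<subseteq>\<^sub>g hs ! i" by simp_all
qed

lemma multi_specialisation_last:
  assumes "multi_specialisation M s (ks @ [g]) (hs @ [h])"
  shows "specialisation (tsys (meta_space M)) (cspec (meta_space M)) s g h"
    "length ks = length (object_spaces M)" "length hs = length ks"
proof -
  show len: "length ks = length (object_spaces M)" "length hs = length ks"
    using multi_specialisation_dest(1,2)[OF assms] by (simp_all add: all_spaces_def)
  show "specialisation (tsys (meta_space M)) (cspec (meta_space M)) s g h"
    using multi_specialisation_dest(3)[OF assms, of "length ks"] len
    by (simp add: all_spaces_def nth_append)
qed

text \<open>Only the last component shrinks, but with it the union of the codomains, from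
  \<open>?U\<close> to \<open>?V\<close>. The conditions on tuple homomorphisms refer to this union
  and have to be established anew for all components.\<close>

lemma multi_specialisation_restrict:
  assumes C: "is_cons_spec (tsys (meta_space M)) (cspec (meta_space M))"
    and s: "multi_specialisation M s (ks @ [g]) (hs @ [h])"
    and e: "structure_graph (tsys (meta_space M)) (cspec (meta_space M)) e" and sub: "e \<subseteq>\<^sub>g g"
  shows "multi_specialisation M s (ks @ [e]) (hs @ [gimage s e h])"
proof -
  let ?T = "\<lambda>i. tsys (all_spaces M ! i)" and ?C = "\<lambda>i. cspec (all_spaces M ! i)"
  note last = multi_specialisation_last[OF s]
  have spec: "specialisation (tsys (meta_space M)) (cspec (meta_space M)) s e (gimage s e h)"
    using specialisation_restrict[OF C last(1) e sub] .
  have all: "specialisation (?T i) (?C i) s ((ks @ [g]) ! i) ((hs @ [h]) ! i)"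
    if "i < length (ks @ [g])" for i
    using multi_specialisation_dest(3)[OF s that] .
  have alle: "specialisation (?T i) (?C i) s ((ks @ [e]) ! i) ((hs @ [gimage s e h]) ! i)"
    if i: "i < length (ks @ [e])" for i
  proof (cases "i < length ks")
    case True
    then show ?thesis using all[of i] last by (simp add: nth_append)
  next
    case False
    then have "i = length ks" using i by simp
    then show ?thesis using spec last by (simp add: nth_append all_spaces_def)
  qed
  let ?U = "gUnion (set (hs @ [h]))" and ?V = "gUnion (set (hs @ [gimage s e h]))"
  have hom: "homomorphism s g h" using last(1)
    by (simp add: specialisation_upto_def isomorphism_def)
  have home: "homomorphism s e h" using homomorphism_subgraph[OF hom sub] .
  have VU: "?V \<subseteq>\<^sub>g ?U" using gimage_subgraph[OF home]
    by (auto simp: gUnion_def subgraph_def)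
  have mono: "gimage s k ?V \<subseteq>\<^sub>g gimage s k ?U" for k
    using VU unfolding subgraph_def gimage_sel by blast
  have im: "gimage s ((ks @ [g]) ! i) ?U \<subseteq>\<^sub>g (hs @ [h]) ! i" if "i < length (ks @ [g])" for i
    using multi_specialisation_dest(4)[OF s that] .
  have ime: "gimage s ((ks @ [e]) ! i) ?V \<subseteq>\<^sub>g (hs @ [gimage s e h]) ! i"
    if i: "i < length (ks @ [e])" for i
  proof (cases "i < length ks")
    case True
    then show ?thesis using subgraph_trans[OF mono im[of i]] last by (simp add: nth_append)
  next
    case False
    \<comment> \<open>The bound required is the image of \<open>e\<close>, not \<open>h\<close>:
      inclusion in \<open>h\<close> is shown first and then cut down by
      \<open>gimage_subgraph_gimage\<close>.\<close>
    then have i: "i = length ks" using i by simp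
    have "gimage s g ?U \<subseteq>\<^sub>g h" using im[of "length ks"] last by (simp add: nth_append)
    moreover have "gimage s e ?V \<subseteq>\<^sub>g gimage s g ?U"
      using subgraph_trans[OF mono] sub unfolding subgraph_def gimage_sel
      using VU by (auto simp: subgraph_def)
    ultimately have "gimage s e ?V \<subseteq>\<^sub>g h" by (rule subgraph_trans[rotated])
    then have "gimage s e ?V \<subseteq>\<^sub>g gimage s e h" by (rule gimage_subgraph_gimage)
    then show ?thesis using i last by (simp add: nth_append)
  qed
  \<comment> \<open>Each component maps into its own codomain, which is a subgraph of
    \<open>?V\<close>.\<close>
  have "homomorphism s k ?V" if "k \<in> set (ks @ [e])" for k
  proof -
    obtain i where i: "i < length (ks @ [e])" "k = (ks @ [e]) ! i"
      using \<open>k \<in> set (ks @ [e])\<close> by (metis in_set_conv_nth)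
    have "homomorphism s k ((hs @ [gimage s e h]) ! i)"
      using alle[OF i(1)] i(2) by (simp add: specialisation_upto_def isomorphism_def)
    moreover have "(hs @ [gimage s e h]) ! i \<in> set (hs @ [gimage s e h])"
      using i(1) last by (intro nth_mem) simp
    ultimately show ?thesis using homomorphism_codomain_mono subgraph_gUnion by blast
  qed
  then have "homomorphism s (gUnion (set (ks @ [e]))) ?V"
    by (rule homomorphism_gUnion)
  then show ?thesis
    using alle ime last
    unfolding multi_specialisation_def tuple_homomorphism_def all_spaces_def by simp
qed

text \<open>In an instantiation of the larger tuple, the last graph \<open>g\<close> is replaced by
  the image of \<open>e\<close> in it.\<close>

lemma instantiatable_restrict:
  assumes C: "is_cons_spec (tsys (meta_space M)) (cspec (meta_space M))"
    and inst: "instantiatable M (hs @ [h])"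
    and e: "structure_graph (tsys (meta_space M)) (cspec (meta_space M)) e" and sub: "e \<subseteq>\<^sub>g h"
  shows "instantiatable M (hs @ [e])"
proof -
  obtain ks s where ks: "belongs_to_system ks M" "multi_specialisation M s (hs @ [h]) ks"
    using inst by (auto simp: instantiatable_def)
  then obtain gs g where gs: "ks = gs @ [g]"
    by (cases ks rule: rev_cases) (auto simp: multi_specialisation_def tuple_homomorphism_def)
  have res: "multi_specialisation M s (hs @ [e]) (gs @ [gimage s e g])"
    using multi_specialisation_restrict[OF C _ e sub] ks gs by blast
  have "homomorphism s h g"
    using multi_specialisation_last(1)[of M s hs h gs g] ks gs
    by (simp add: specialisation_upto_def isomorphism_def)
  then have "gimage s e g \<subseteq>\<^sub>g g" using gimage_subgraph homomorphism_subgraph sub by blast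
  then have "belongs_to (gimage s e g) (meta_space M)"
    if "g \<subseteq>\<^sub>g realm (meta_space M)"
    using that multi_specialisation_last(1)[OF res] subgraph_trans
    by (auto simp: belongs_to_def specialisation_upto_def)
  moreover have "list_all2 belongs_to gs (object_spaces M)" "g \<subseteq>\<^sub>g realm (meta_space M)"
    using ks(1) gs multi_specialisation_last(2,3)[of M s hs h gs g] ks(2)
    by (auto simp: belongs_to_system_def all_spaces_def list_all2_append belongs_to_def)
  ultimately have "belongs_to_system (gs @ [gimage s e g]) M"
    by (auto simp: belongs_to_system_def all_spaces_def intro: list_all2_appendI)
  then show ?thesis using res by (auto simp: instantiatable_def)
qed


section \<open>Rules for schemas\<close>

text \<open>A pattern space shares type system and constructor specification with its space, so
  structure graphs for the meta-spaces of \<open>M\<close> and of \<open>P\<close> are the same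
  notion.\<close>

lemma pattern_system_meta:
  assumes "pattern_system M P"
  shows "construction_space (meta_space P)"
    "tsys (meta_space P) = tsys (meta_space M)" "cspec (meta_space P) = cspec (meta_space M)"
    "length (object_spaces P) = length (object_spaces M)"
proof -
  have l: "list_all2 pattern_space (object_spaces M @ [meta_space M])
      (object_spaces P @ [meta_space P])"
    using assms by (simp add: pattern_system_def all_spaces_def)
  from list_all2_lengthD[OF this]
  show len: "length (object_spaces P) = length (object_spaces M)" by simp
  have "pattern_space (meta_space M) (meta_space P)"
    using l len by (simp add: list_all2_append)
  then show "construction_space (meta_space P)" "tsys (meta_space P) = tsys (meta_space M)"
    "cspec (meta_space P) = cspec (meta_space M)" by (auto simp: pattern_space_def)
qed

lemma belongs_to_system_snoc:
  "belongs_to_system (gs @ [g]) P \<longleftrightarrow>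
     list_all2 belongs_to gs (object_spaces P) \<and> belongs_to g (meta_space P)"
  unfolding belongs_to_system_def all_spaces_def
\<comment> \<open>\<open>list_all2_append\<close> splits lists with prefixes of equal length;
  otherwise both sides are false.\<close>
proof (cases "length gs = length (object_spaces P)")
  case True
  then show "list_all2 belongs_to (gs @ [g]) (object_spaces P @ [meta_space P]) \<longleftrightarrow>
      list_all2 belongs_to gs (object_spaces P) \<and> belongs_to g (meta_space P)"
    by (simp add: list_all2_append)
next
  case False
  then show "list_all2 belongs_to (gs @ [g]) (object_spaces P @ [meta_space P]) \<longleftrightarrow>
      list_all2 belongs_to gs (object_spaces P) \<and> belongs_to g (meta_space P)"
    by (auto dest: list_all2_lengthD)
qed

lemma schemaD:
  assumes "schema M P (Sequent \<kappa>s \<alpha> \<gamma>)" "belongs_to_system (\<kappa>s' @ [\<alpha>']) P"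
    "multi_specialisation M s (\<kappa>s @ [\<alpha>]) (\<kappa>s' @ [\<alpha>'])" "instantiatable M (\<kappa>s' @ [\<alpha>'])"
  obtains \<gamma>' s' where "belongs_to \<gamma>' (meta_space P)"
    "\<forall>x\<in>carrier (gUnion (set (\<kappa>s @ [\<alpha>]))). s' x = s x"
    "multi_specialisation M s' (\<kappa>s @ [\<alpha> \<union>\<^sub>g \<gamma>]) (\<kappa>s' @ [\<alpha>' \<union>\<^sub>g \<gamma>'])"
    "instantiatable M (\<kappa>s' @ [\<alpha>' \<union>\<^sub>g \<gamma>'])"
proof -
  note assms(1)[unfolded schema.simps, THEN conjunct2, rule_format,
      OF conjI[OF assms(2) conjI[OF assms(3,4)]]]
  then show thesis using that by blast
qed

lemma schema_weaken:
  assumes P: "pattern_system M P" and S: "schema M P (Sequent \<kappa>s \<alpha> \<delta>)"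
    and \<gamma>: "belongs_to \<gamma> (meta_space P)" and sub: "\<gamma> \<subseteq>\<^sub>g \<alpha> \<union>\<^sub>g \<delta>"
  shows "schema M P (Sequent \<kappa>s \<alpha> \<gamma>)"
  unfolding schema.simps
proof (intro conjI allI impI; (elim conjE)?)
  have seq: "belongs_to_system (\<kappa>s @ [\<alpha>]) P" using S by simp
  then show "is_sequent P (Sequent \<kappa>s \<alpha> \<gamma>)" using \<gamma> by simp
  note meta = pattern_system_meta[OF P]
  let ?T = "tsys (meta_space M)" and ?C = "cspec (meta_space M)"
  have C: "is_cons_spec ?T ?C" using meta by (metis construction_space_def)
  fix s \<kappa>s' \<alpha>'
  assume A: "belongs_to_system (\<kappa>s' @ [\<alpha>']) P"
    "multi_specialisation M s (\<kappa>s @ [\<alpha>]) (\<kappa>s' @ [\<alpha>'])" "instantiatable M (\<kappa>s' @ [\<alpha>'])"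
  obtain s' \<delta>' where \<delta>': "belongs_to \<delta>' (meta_space P)"
    and eq: "\<forall>x\<in>carrier (gUnion (set (\<kappa>s @ [\<alpha>]))). s' x = s x"
    and s': "multi_specialisation M s' (\<kappa>s @ [\<alpha> \<union>\<^sub>g \<delta>]) (\<kappa>s' @ [\<alpha>' \<union>\<^sub>g \<delta>'])"
    and inst: "instantiatable M (\<kappa>s' @ [\<alpha>' \<union>\<^sub>g \<delta>'])"
    using schemaD[OF S A] .
  have \<alpha>: "belongs_to \<alpha> (meta_space P)" and \<alpha>': "belongs_to \<alpha>' (meta_space P)"
    using seq A(1) by (auto simp: belongs_to_system_snoc)
  define k where "k = \<alpha>' \<union>\<^sub>g \<delta>'"
  define e where "e = \<alpha> \<union>\<^sub>g \<gamma>"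
  have k: "structure_graph ?T ?C k" "k \<subseteq>\<^sub>g realm (meta_space P)"
    using belongs_to_gunion[OF meta(1) \<alpha>' \<delta>'] meta by (auto simp: belongs_to_def k_def)
  have e: "structure_graph ?T ?C e"
    using belongs_to_gunion[OF meta(1) \<alpha> \<gamma>] meta by (auto simp: belongs_to_def e_def)
  have esub: "e \<subseteq>\<^sub>g \<alpha> \<union>\<^sub>g \<delta>"
    unfolding e_def using sub subgraph_gunion1 by (intro gunion_subgraph)
  have spec: "specialisation ?T ?C s' (\<alpha> \<union>\<^sub>g \<delta>) k"
    using multi_specialisation_last(1)[OF s'] by (simp add: k_def)
  have \<gamma>st: "structure_graph ?T ?C \<gamma>" using \<gamma> meta by (simp add: belongs_to_def)
  \<comment> \<open>The witness for the new conclusion: the part of \<alpha>' \<union> \<delta>'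
    onto which \<open>s'\<close> maps \<gamma>.\<close>
  let ?\<gamma>' = "gimage s' \<gamma> k"
  have "specialisation ?T ?C s' \<gamma> ?\<gamma>'" using specialisation_restrict[OF C spec \<gamma>st sub] .
  moreover have "?\<gamma>' \<subseteq>\<^sub>g k"
    using spec sub gimage_subgraph homomorphism_subgraph
    by (metis specialisation_upto_def isomorphism_def)
  ultimately have 1: "belongs_to ?\<gamma>' (meta_space P)"
    using k(2) meta subgraph_trans by (auto simp: belongs_to_def specialisation_upto_def)
  \<comment> \<open>A schema requires a codomain of the form \<alpha>' \<union> \<gamma>', with the
    given \<alpha>'. As \<open>s'\<close> agrees with \<open>s\<close> on \<alpha>, the image of
    \<alpha> \<union> \<gamma> has this form.\<close>
  have "gimage s' \<alpha> k = \<alpha>'"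
  proof (rule specialisation_gimage_eq[OF C multi_specialisation_last(1)[OF A(2)] k(1)])
    show "\<alpha>' \<subseteq>\<^sub>g k" unfolding k_def by (rule subgraph_gunion1)
    show "\<And>x. x \<in> carrier \<alpha> \<Longrightarrow> s' x = s x"
      using eq by (auto simp: carrier_def gUnion_def)
  qed
  then have im: "gimage s' e k = \<alpha>' \<union>\<^sub>g ?\<gamma>'" unfolding e_def gimage_gunion by simp
  have 2: "multi_specialisation M s' (\<kappa>s @ [\<alpha> \<union>\<^sub>g \<gamma>]) (\<kappa>s' @ [\<alpha>' \<union>\<^sub>g ?\<gamma>'])"
    using multi_specialisation_restrict[OF C s' e esub] im unfolding k_def e_def by simp
  have "structure_graph ?T ?C (\<alpha>' \<union>\<^sub>g ?\<gamma>')"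
    using multi_specialisation_last(1)[OF 2] by (simp add: specialisation_upto_def)
  moreover have "\<alpha>' \<union>\<^sub>g ?\<gamma>' \<subseteq>\<^sub>g \<alpha>' \<union>\<^sub>g \<delta>'"
    using \<open>?\<gamma>' \<subseteq>\<^sub>g k\<close> subgraph_gunion1 unfolding k_def by (intro gunion_subgraph)
  ultimately have "instantiatable M (\<kappa>s' @ [\<alpha>' \<union>\<^sub>g ?\<gamma>'])"
    by (rule instantiatable_restrict[OF C inst])
  with 1 2 eq show "\<exists>s' \<gamma>'. belongs_to \<gamma>' (meta_space P) \<and>
      (\<forall>x\<in>carrier (gUnion (set (\<kappa>s @ [\<alpha>]))). s' x = s x) \<and>
      multi_specialisation M s' (\<kappa>s @ [\<alpha> \<union>\<^sub>g \<gamma>]) (\<kappa>s' @ [\<alpha>' \<union>\<^sub>g \<gamma>']) \<and>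
      instantiatable M (\<kappa>s' @ [\<alpha>' \<union>\<^sub>g \<gamma>'])" by blast
qed

lemma schema_cut:
  assumes P: "pattern_system M P" and S1: "schema M P (Sequent \<kappa>s \<alpha> \<delta>)"
    and S2: "schema M P (Sequent \<kappa>s (\<alpha> \<union>\<^sub>g \<delta>) \<gamma>)"
  shows "schema M P (Sequent \<kappa>s \<alpha> \<gamma>)"
proof -
  note meta = pattern_system_meta[OF P]
  have \<gamma>: "belongs_to \<gamma> (meta_space P)" and \<delta>: "belongs_to \<delta> (meta_space P)"
    and seq: "belongs_to_system (\<kappa>s @ [\<alpha>]) P"
    using S1 S2 by auto
  \<comment> \<open>Chaining the two extensions yields a specialisation of \<alpha> \<union>
    \<delta> \<union> \<gamma>, so \<delta> is kept in the conclusion and dropped by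
    \<open>schema_weaken\<close> at the end.\<close>
  have "schema M P (Sequent \<kappa>s \<alpha> (\<delta> \<union>\<^sub>g \<gamma>))"
    unfolding schema.simps
  proof (intro conjI allI impI; (elim conjE)?)
    show "is_sequent P (Sequent \<kappa>s \<alpha> (\<delta> \<union>\<^sub>g \<gamma>))"
      using seq belongs_to_gunion[OF meta(1) \<delta> \<gamma>] by simp
    fix s \<kappa>s' \<alpha>'
    assume A: "belongs_to_system (\<kappa>s' @ [\<alpha>']) P"
      "multi_specialisation M s (\<kappa>s @ [\<alpha>]) (\<kappa>s' @ [\<alpha>'])" "instantiatable M (\<kappa>s' @ [\<alpha>'])"
    obtain s1 \<delta>' where \<delta>': "belongs_to \<delta>' (meta_space P)"
      and eq1: "\<forall>x\<in>carrier (gUnion (set (\<kappa>s @ [\<alpha>]))). s1 x = s x"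
      and s1: "multi_specialisation M s1 (\<kappa>s @ [\<alpha> \<union>\<^sub>g \<delta>]) (\<kappa>s' @ [\<alpha>' \<union>\<^sub>g \<delta>'])"
      and inst1: "instantiatable M (\<kappa>s' @ [\<alpha>' \<union>\<^sub>g \<delta>'])"
      using schemaD[OF S1 A] .
    \<comment> \<open>The extension \<open>s1\<close> is itself an instantiatable specialisation of
      the antecedent of \<open>S2\<close>, which can thus be applied to it.\<close>
    have "belongs_to_system (\<kappa>s' @ [\<alpha>' \<union>\<^sub>g \<delta>']) P"
      using A(1) belongs_to_gunion[OF meta(1) _ \<delta>'] by (auto simp: belongs_to_system_snoc)
    from schemaD[OF S2 this s1 inst1]
    obtain s2 \<gamma>' where \<gamma>': "belongs_to \<gamma>' (meta_space P)"
      and eq2: "\<forall>x\<in>carrier (gUnion (set (\<kappa>s @ [\<alpha> \<union>\<^sub>g \<delta>]))). s2 x = s1 x"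
      and s2: "multi_specialisation M s2 (\<kappa>s @ [\<alpha> \<union>\<^sub>g \<delta> \<union>\<^sub>g \<gamma>]) (\<kappa>s' @ [\<alpha>' \<union>\<^sub>g \<delta>' \<union>\<^sub>g \<gamma>'])"
      and inst2: "instantiatable M (\<kappa>s' @ [\<alpha>' \<union>\<^sub>g \<delta>' \<union>\<^sub>g \<gamma>'])" .
    have "carrier (gUnion (set (\<kappa>s @ [\<alpha>]))) \<subseteq> carrier (gUnion (set (\<kappa>s @ [\<alpha> \<union>\<^sub>g \<delta>])))"
      by (auto simp: carrier_def gUnion_def)
    then have "\<forall>x\<in>carrier (gUnion (set (\<kappa>s @ [\<alpha>]))). s2 x = s x"
      using eq1 eq2 by (simp add: subset_iff)
    then show "\<exists>s' \<gamma>'. belongs_to \<gamma>' (meta_space P) \<and>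
      (\<forall>x\<in>carrier (gUnion (set (\<kappa>s @ [\<alpha>]))). s' x = s x) \<and>
      multi_specialisation M s' (\<kappa>s @ [\<alpha> \<union>\<^sub>g (\<delta> \<union>\<^sub>g \<gamma>)]) (\<kappa>s' @ [\<alpha>' \<union>\<^sub>g \<gamma>']) \<and>
      instantiatable M (\<kappa>s' @ [\<alpha>' \<union>\<^sub>g \<gamma>'])"
      using belongs_to_gunion[OF meta(1) \<delta>' \<gamma>'] s2 inst2 unfolding gunion_assoc by blast
  qed
  moreover have "\<gamma> \<subseteq>\<^sub>g \<alpha> \<union>\<^sub>g (\<delta> \<union>\<^sub>g \<gamma>)"
    using subgraph_gunion2 subgraph_trans by blast
  ultimately show ?thesis using schema_weaken[OF P _ \<gamma>] by blast
qed

text \<open>Values of \<open>the (r x)\<close> outside \<open>dom r\<close> can only enlarge the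
  total image. Since \<open>pimage r g h\<close> reads incidence and labels from \<open>h\<close>,
  only vertices and arrows have to be compared, whatever \<open>k\<close> is.\<close>

lemma pimage_subgraph_of_gimage:
  assumes "gimage (\<lambda>x. the (r x)) g k \<subseteq>\<^sub>g h"
  shows "pimage r g h \<subseteq>\<^sub>g h"
proof -
  have "{y. \<exists>x\<in>X. r x = Some y} \<subseteq> (\<lambda>x. the (r x)) ` X" for X
    by (force simp: image_iff)
  then show ?thesis
    using assms unfolding subgraph_def gimage_sel
    by (simp add: pimage_def Let_def subset_iff)
qed

lemma refinement_schema:
  assumes P: "pattern_system M P" and R: "refinement_of M P S (Sequent \<kappa>s' \<alpha>' \<gamma>')"
  shows "schema M P (Sequent \<kappa>s' \<alpha>' \<gamma>')"
proof -
  obtain \<kappa>s \<alpha> \<gamma> where S: "S = Sequent \<kappa>s \<alpha> \<gamma>" by (cases S)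
  obtain r where
    w: "weakening_map M P r (Sequent \<kappa>s \<alpha> \<gamma>)
          (Sequent \<kappa>s' \<alpha>' (pimage r \<gamma> (realm (meta_space P))))"
    and m: "monotonic_for M P (Sequent (map2 (pimage r) \<kappa>s \<kappa>s') (pimage r \<alpha> \<alpha>')
          (pimage r \<gamma> (realm (meta_space P)))) \<kappa>s' \<alpha>'"
    and sub: "\<gamma>' \<subseteq>\<^sub>g \<alpha>' \<union>\<^sub>g pimage r \<gamma> (realm (meta_space P))"
    using R unfolding S refinement_of.simps Let_def by blast
  have \<gamma>': "belongs_to \<gamma>' (meta_space P)" using R unfolding S by simp
  have th: "tuple_homomorphism (\<lambda>x. the (r x)) (\<kappa>s @ [\<alpha>]) (\<kappa>s' @ [\<alpha>'])"
    using w by (simp add: multi_reification_def)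
  then have len: "length \<kappa>s = length \<kappa>s'" by (simp add: tuple_homomorphism_def)
  have im: "pimage r ((\<kappa>s @ [\<alpha>]) ! i) ((\<kappa>s' @ [\<alpha>']) ! i) \<subseteq>\<^sub>g (\<kappa>s' @ [\<alpha>']) ! i"
    if "i < length (\<kappa>s @ [\<alpha>])" for i
    using th that pimage_subgraph_of_gimage unfolding tuple_homomorphism_def by blast
  \<comment> \<open>The unions in \<open>monotonic_for\<close> collapse by absorption, here for the
    antecedent in the meta-space and then for the other components.\<close>
  have "pimage r \<alpha> \<alpha>' \<union>\<^sub>g \<alpha>' = \<alpha>'"
    using im[of "length \<kappa>s"] len by (intro gunion_absorb) (simp add: nth_append)
  moreover have "map2 (\<union>\<^sub>g) (map2 (pimage r) \<kappa>s \<kappa>s') \<kappa>s' = \<kappa>s'"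
  proof (rule nth_equalityI)
    fix i assume "i < length (map2 (\<union>\<^sub>g) (map2 (pimage r) \<kappa>s \<kappa>s') \<kappa>s')"
    then have i: "i < length \<kappa>s" "i < length \<kappa>s'" using len by auto
    then have "pimage r (\<kappa>s ! i) (\<kappa>s' ! i) \<subseteq>\<^sub>g \<kappa>s' ! i"
      using im[of i] by (simp add: nth_append)
    then show "map2 (\<union>\<^sub>g) (map2 (pimage r) \<kappa>s \<kappa>s') \<kappa>s' ! i = \<kappa>s' ! i"
      using i gunion_absorb by simp
  qed (use len in simp)
  ultimately have "schema M P (Sequent \<kappa>s' \<alpha>' (pimage r \<gamma> (realm (meta_space P))))"
    using m unfolding monotonic_for.simps by argo
  then show ?thesis using schema_weaken[OF P _ \<gamma>' sub] by blast
qed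

text \<open>The two kinds of application differ in which premise of the cut is the refinement: the
  first premise for kind (1), the second for kind (2). The other premise is \<sigma>'.\<close>

lemma application_schema:
  assumes P: "pattern_system M P" and A: "application_of M P S \<sigma> \<sigma>'" and \<sigma>': "schema M P \<sigma>'"
  shows "schema M P \<sigma>"
proof -
  obtain \<kappa>s \<alpha> \<gamma> where \<sigma>: "\<sigma> = Sequent \<kappa>s \<alpha> \<gamma>" by (cases \<sigma>)
  consider \<delta> where "\<sigma>' = Sequent \<kappa>s (\<alpha> \<union>\<^sub>g \<delta>) \<gamma>" "refinement_of M P S (Sequent \<kappa>s \<alpha> \<delta>)"
    | \<delta> where "\<sigma>' = Sequent \<kappa>s \<alpha> \<delta>" "refinement_of M P S (Sequent \<kappa>s (\<alpha> \<union>\<^sub>g \<delta>) \<gamma>)"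
    using A unfolding \<sigma> application_of.simps by blast
  then show ?thesis
    using \<sigma>' refinement_schema[OF P] schema_cut[OF P] unfolding \<sigma> by cases blast+
qed

theorem theorem4p3:
  fixes M P :: "('x, 'ty, 'co) multi_space"
    and \<S> :: "('x, 'ty, 'co) sequent set"
    and \<kappa>s' :: "('x, 'ty, 'co) graph list"
    and \<alpha>' \<gamma>' :: "('x, 'ty, 'co) graph"
  assumes "multi_space_system M"
    and "pattern_system M P"
    and "\<And>S. S \<in> \<S> \<Longrightarrow> schema M P S"
    and "is_sequent P (Sequent \<kappa>s' \<alpha>' \<gamma>')"
    and "valid_over M P \<S> (Sequent \<kappa>s' \<alpha>' \<gamma>')"
  shows "schema M P (Sequent \<kappa>s' \<alpha>' \<gamma>')"
  using assms(5)
proof induction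
  case (schema_valid \<sigma>)
  then show ?case by (rule assms(3))
next
  \<comment> \<open>The schema property travels backwards along a derivation, from the application
    \<sigma>' to the sequent \<sigma>.\<close>
  case (application_valid \<sigma> S \<sigma>')
  then show ?case using application_schema[OF assms(2)] by blast
qed

end
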